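(* Let $K$ be a field (with the standing assumption on $\mathrm{char}(K)$ given in the context) and let $I\subset S=K[x_1,\dots,x_n]$ be a monomial ideal. If $I$ is stable, then $\partial(I)$ is stable. If $I$ is strongly stable, then $\partial(I)$ is strongly stable. In particular, in either case, $\mathrm{reg}\,\partial(I)\le\mathrm{reg}\,I$.
   Context: $S=K[x_1,\dots,x_n]$ is the standard graded polynomial ring over the field $K$. For a homogeneous ideal $I\subset S$, the gradient ideal $\partial(I)$ is the ideal generated by all partial derivatives $\partial f/\partial x_i$ ($1\le i\le n$) of the elements $f$ of a minimal generating set of $I$. For a monomial ideal $I$, $\mathcal{G}(I)$ denotes its minimal monomial generating set, and $\mathrm{supp}(u)=\{i: x_i \text{ divides } u\}$ for a monomial $u$. Standing assumption: $\mathrm{char}(K)=0$, or $\mathrm{char}(K)$ is large enough that for every monomial ideal $I$ under consideration $$\partial(I)=(u/x_i:\ u\in\mathcal{G}(I),\ i\in\mathrm{supp}(u)).$$ For a monomial $u\ne1$, $\max(u)=\max\mathrm{supp}(u)$. A monomial ideal $I\subset S$ is stable if for all monomials $u\in I$ with $u\neq1$ and all $i<\max(u)$ one has $x_i(u/x_{\max(u)})\in I$. It is strongly stable if for all monomials $u\in I$ and all $i<j$ with $x_j$ dividing $u$ one has $x_i(u/x_j)\in I$. For a homogeneous ideal $I$, $\mathrm{reg}\,I=\max\{j-i:\ \dim_K\mathrm{Tor}^S_i(K,I)_j\neq 0\}$ is the Castelnuovo–Mumford regularity (with $\max\emptyset=-\infty$). *)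

theory Defs
  imports Complex_Main "HOL-Library.Poly_Mapping" "HOL-Library.Extended_Real"
begin

section \<open>The polynomial ring\<close>

text \<open>
  The variables are indexed by a finite linearly ordered type; \<open>'n\<close> plays the role of
  \<open>{1, \<dots>, n}\<close> with its order and \<open>n = CARD('n)\<close>. A monomial is given by its exponent vector,
  and multiplication of polynomials is the convolution product of \<^theory>\<open>HOL-Library.Poly_Mapping\<close>.
\<close>

type_synonym 'n expo = "'n \<Rightarrow>\<^sub>0 nat"

type_synonym ('n, 'k) mpol = "'n expo \<Rightarrow>\<^sub>0 'k"

abbreviation supp :: "'n expo \<Rightarrow> 'n set"
  where "supp u \<equiv> Poly_Mapping.keys u"

abbreviation var_expo :: "'n \<Rightarrow> 'n expo"
  where "var_expo i \<equiv> Poly_Mapping.single i 1"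

definition xmon :: "'n expo \<Rightarrow> ('n, 'k::zero_neq_one) mpol"
  where "xmon u = Poly_Mapping.single u 1"

definition mdeg :: "'n::finite expo \<Rightarrow> nat"
  where "mdeg u = (\<Sum>i\<in>UNIV. Poly_Mapping.lookup u i)"

text \<open>Degrees are integers, since twisted free modules \<open>S(-e)\<close> occur below.\<close>

definition homogeneous_of_degree :: "int \<Rightarrow> ('n::finite, 'k::zero) mpol \<Rightarrow> bool"
  where "homogeneous_of_degree j f \<longleftrightarrow> (\<forall>u\<in>Poly_Mapping.keys f. int (mdeg u) = j)"

definition homogeneous :: "('n::finite, 'k::zero) mpol \<Rightarrow> bool"
  where "homogeneous f \<longleftrightarrow> (\<exists>j. homogeneous_of_degree j f)"

definition ideal_gen :: "('n, 'k::comm_ring_1) mpol set \<Rightarrow> ('n, 'k) mpol set"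
  where "ideal_gen F = module.span (*) F"

definition partial_deriv :: "'n \<Rightarrow> ('n, 'k::comm_ring_1) mpol \<Rightarrow> ('n, 'k) mpol"
  where "partial_deriv i f =
    (\<Sum>u\<in>Poly_Mapping.keys f.
       Poly_Mapping.single (u - var_expo i)
         (of_nat (Poly_Mapping.lookup u i) * Poly_Mapping.lookup f u))"


section \<open>Monomial ideals and gradient ideals\<close>

definition monomial_ideal :: "('n, 'k::comm_ring_1) mpol set \<Rightarrow> bool"
  where "monomial_ideal I \<longleftrightarrow> (\<exists>A. I = ideal_gen (xmon ` A))"

text \<open>The exponents of the monomials in \<open>I\<close> that are minimal with respect to divisibility.\<close>

definition min_monomials :: "('n, 'k::comm_ring_1) mpol set \<Rightarrow> 'n expo set"
  where "min_monomials I =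
    {u. xmon u \<in> I \<and>
        (\<forall>v. xmon v \<in> I \<and> (xmon v :: ('n, 'k) mpol) dvd xmon u \<longrightarrow> v = u)}"

text \<open>
  Minimality is with respect to inclusion; generators of a homogeneous ideal are taken to be
  homogeneous.
\<close>

definition minimal_generating_set ::
    "('n::finite, 'k::comm_ring_1) mpol set \<Rightarrow> ('n, 'k) mpol set \<Rightarrow> bool"
  where "minimal_generating_set F I \<longleftrightarrow>
    (\<forall>f\<in>F. homogeneous f) \<and> ideal_gen F = I \<and> (\<forall>G. G \<subset> F \<longrightarrow> ideal_gen G \<noteq> I)"

text \<open>
  If \<open>F\<close> is a minimal generating set of the homogeneous ideal \<open>I\<close>, this is the gradient ideal
  \<open>\<partial>(I)\<close>. Independence of the choice of \<open>F\<close> can fail in positive characteristic, so \<open>F\<close> is kept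
  as the argument.
\<close>

definition gradient_ideal :: "('n, 'k::comm_ring_1) mpol set \<Rightarrow> ('n, 'k) mpol set"
  where "gradient_ideal F = ideal_gen {partial_deriv i f | i f. f \<in> F}"

definition stable_ideal :: "('n::linorder, 'k::comm_ring_1) mpol set \<Rightarrow> bool"
  where "stable_ideal I \<longleftrightarrow> monomial_ideal I \<and>
    (\<forall>u. xmon u \<in> I \<and> u \<noteq> 0 \<longrightarrow>
      (\<forall>i < Max (supp u). xmon (var_expo i + (u - var_expo (Max (supp u)))) \<in> I))"

definition strongly_stable_ideal :: "('n::linorder, 'k::comm_ring_1) mpol set \<Rightarrow> bool"
  where "strongly_stable_ideal I \<longleftrightarrow> monomial_ideal I \<and>
    (\<forall>u. xmon u \<in> I \<longrightarrow>
      (\<forall>j \<in> supp u. \<forall>i < j. xmon (var_expo i + (u - var_expo j)) \<in> I))"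


section \<open>Graded free resolutions of the residue field\<close>

text \<open>
  A sequence of finitely generated graded free modules
  \<open>P\<^sub>i = \<Oplus>\<^sub>k S(-gshift i k)\<close> with \<open>k < grank i\<close>, together with matrices for
  \<open>P\<^sub>i\<^sub>+\<^sub>1 \<rightarrow> P\<^sub>i\<close>: \<open>gmat i k l\<close> is the coefficient of the \<open>l\<close>-th basis element of \<open>P\<^sub>i\<close> in the
  image of the \<open>k\<close>-th basis element of \<open>P\<^sub>i\<^sub>+\<^sub>1\<close>.
\<close>

record (overloaded) ('n, 'k) free_cplx =
  grank :: "nat \<Rightarrow> nat"
  gshift :: "nat \<Rightarrow> nat \<Rightarrow> int"
  gmat :: "nat \<Rightarrow> nat \<Rightarrow> nat \<Rightarrow> ('n, 'k) mpol"

text \<open>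
  \<open>cmod P I i\<close> consists of the vectors of \<open>P\<^sub>i\<close> with entries in the ideal \<open>I\<close>. It is \<open>P\<^sub>i\<close> itself for
  \<open>I = UNIV\<close>; in general it is \<open>P\<^sub>i \<otimes>\<^sub>S I\<close> under the canonical isomorphism \<open>S\<^sup>r \<otimes>\<^sub>S I \<cong> I\<^sup>r\<close>, under
  which the differential of \<open>P \<otimes>\<^sub>S I\<close> is given by the same matrices.
\<close>

definition cmod ::
    "('n, 'k::zero) free_cplx \<Rightarrow> ('n, 'k) mpol set \<Rightarrow> nat \<Rightarrow> (nat \<Rightarrow> ('n, 'k) mpol) set"
  where "cmod P I i = {v. (\<forall>k < grank P i. v k \<in> I) \<and> (\<forall>k \<ge> grank P i. v k = 0)}"

definition cmod_deg ::
    "('n::finite, 'k::zero) free_cplx \<Rightarrow> ('n, 'k) mpol set \<Rightarrow> nat \<Rightarrow> int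
      \<Rightarrow> (nat \<Rightarrow> ('n, 'k) mpol) set"
  where "cmod_deg P I i j =
    {v \<in> cmod P I i. \<forall>k < grank P i. homogeneous_of_degree (j - gshift P i k) (v k)}"

fun cdiff ::
    "('n, 'k::comm_ring_1) free_cplx \<Rightarrow> nat \<Rightarrow> (nat \<Rightarrow> ('n, 'k) mpol) \<Rightarrow> (nat \<Rightarrow> ('n, 'k) mpol)"
  where
    "cdiff P 0 v = (\<lambda>l. 0)"
  | "cdiff P (Suc i) v =
      (\<lambda>l. if l < grank P i then \<Sum>k < grank P (Suc i). v k * gmat P i k l else 0)"

text \<open>
  The \<open>S\<close>-linear map \<open>P\<^sub>0 \<rightarrow> K\<close> sending the \<open>k\<close>-th basis element to \<open>e k\<close>; here \<open>S\<close> acts on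
  \<open>K = S/(x\<^sub>1, \<dots>, x\<^sub>n)\<close> through the constant term.
\<close>

definition augmentation ::
    "('n, 'k::comm_ring_1) free_cplx \<Rightarrow> (nat \<Rightarrow> 'k) \<Rightarrow> (nat \<Rightarrow> ('n, 'k) mpol) \<Rightarrow> 'k"
  where "augmentation P e v = (\<Sum>k < grank P 0. Poly_Mapping.lookup (v k) 0 * e k)"

text \<open>
  An exact complex \<open>\<dots> \<rightarrow> P\<^sub>1 \<rightarrow> P\<^sub>0 \<rightarrow> K \<rightarrow> 0\<close> whose maps are homogeneous of degree \<open>0\<close>, with \<open>K\<close>
  in degree \<open>0\<close>.
\<close>

definition graded_free_resolution_of_field ::
    "('n::finite, 'k::field) free_cplx \<Rightarrow> (nat \<Rightarrow> 'k) \<Rightarrow> bool"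
  where "graded_free_resolution_of_field P e \<longleftrightarrow>
    (\<forall>i. \<forall>k < grank P (Suc i). \<forall>l < grank P i.
       homogeneous_of_degree (gshift P (Suc i) k - gshift P i l) (gmat P i k l)) \<and>
    (\<forall>k < grank P 0. e k \<noteq> 0 \<longrightarrow> gshift P 0 k = 0) \<and>
    augmentation P e ` cmod P UNIV 0 = UNIV \<and>
    {v \<in> cmod P UNIV 0. augmentation P e v = 0} = cdiff P 1 ` cmod P UNIV 1 \<and>
    (\<forall>i \<ge> 1. {v \<in> cmod P UNIV i. cdiff P i v = (\<lambda>l. 0)} = cdiff P (Suc i) ` cmod P UNIV (Suc i))"


section \<open>Tor and Castelnuovo-Mumford regularity\<close>

text \<open>
  \<open>Tor\<^sub>i(K, I)\<^sub>j \<noteq> 0\<close>, i.e. the degree \<open>j\<close> part of \<open>H\<^sub>i(P \<otimes>\<^sub>S I)\<close> is not zero, for a graded free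
  resolution \<open>P\<close> of \<open>K\<close>. As \<open>Tor\<close> does not depend on the resolution, the existential quantifier
  could equally be a universal one.
\<close>

definition Tor_nonzero :: "nat \<Rightarrow> ('n::finite, 'k::field) mpol set \<Rightarrow> int \<Rightarrow> bool"
  where "Tor_nonzero i I j \<longleftrightarrow>
    (\<exists>P e. graded_free_resolution_of_field P e \<and>
       {v \<in> cmod_deg P I i j. cdiff P i v = (\<lambda>l. 0)} \<noteq> cdiff P (Suc i) ` cmod_deg P I (Suc i) j)"

text \<open>
  The supremum in the extended reals is the maximum of the (finite) set of differences, and it is
  \<open>-\<infinity>\<close> for the zero ideal.
\<close>

definition cm_reg :: "('n::finite, 'k::field) mpol set \<Rightarrow> ereal"
  where "cm_reg I = Sup {ereal (real_of_int (j - int i)) | i j. Tor_nonzero i I j}"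

end

theory Submission
  imports Defs
begin

text \<open>
  A monomial ideal is determined by the set \<open>U\<close> of exponents of its monomials. If \<open>I\<close> is proper, the
  monomials of \<open>\<partial>(I)\<close> are the \<open>v\<close> such that \<open>v x\<^sub>i \<in> I\<close> for some \<open>i\<close> (\<open>gradient_expos_eq\<close>), and from this
  description both kinds of stability pass from \<open>I\<close> to \<open>\<partial>(I)\<close>: strong stability because an exchange in
  \<open>v\<close> is also one in \<open>v x\<^sub>i\<close>, stability by comparing \<open>x\<^sub>i\<close> with the largest variable of \<open>v\<close>. In characteristic \<open>0\<close> the description of \<open>\<partial>(I)\<close> by monomials holds for every minimal set of
  homogeneous generators, by Euler's formula and the product rule (\<open>gradient_ideal_char_0\<close>).

  For the regularity, the key fact is that a stable ideal \<open>J\<close> with generators of degree at most \<open>d\<close> has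
  regularity at most \<open>d\<close> (\<open>regularity_le_stable\<close>). Such an ideal is built from \<open>0\<close> by adjoining
  finitely many monomials of degree at most \<open>d\<close> so that every colon ideal met on the way is generated by
  variables: first the monomials of degree \<open>d\<close> in lexicographically decreasing order, then those of
  lower degree by decreasing degree. Each successive quotient is \<open>S(-deg u)\<close> modulo some
  variables, and the vanishing of \<open>Tor\<close> for \<open>S\<close> modulo variables follows by adjoining the variables one
  at a time, starting from the exactness of the given resolution \<open>P\<close> of \<open>K\<close>. All this works for
  an arbitrary \<open>P\<close>, and is carried out with explicit cycles modulo a monomial ideal.

  Conversely, a minimal monomial generator of degree \<open>d\<close> of \<open>I\<close> makes \<open>Tor\<^sub>0(K, I)\<^sub>d\<close> nonzero
  (\<open>Tor_zero_nonzero_at_generator\<close>). So \<open>reg I\<close> is at least each generator degree of \<open>I\<close>, whereas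
  \<open>\<partial>(I)\<close> is stable and generated in smaller degrees. No resolution of \<open>K\<close> has to be constructed for
  this: a nonzero \<open>Tor\<^sub>i(K, \<partial>(I))\<^sub>j\<close> supplies one, which also computes \<open>Tor\<^sub>0(K, I)\<close>.
\<close>

section \<open>Monomials and monomial ideals\<close>

lemma mpol_eq_sum_terms:
  "f = (\<Sum>u\<in>Poly_Mapping.keys f. Poly_Mapping.single u (Poly_Mapping.lookup f u))"
  by (rule poly_mapping_eqI)
    (auto simp: lookup_sum lookup_single when_def in_keys_iff sum.delta[OF finite_keys])

lemma mpol_induct [case_names single add]:
  assumes single: "\<And>u c. P (Poly_Mapping.single u c)"
    and add: "\<And>f g. P f \<Longrightarrow> P g \<Longrightarrow> P (f + g)"
  shows "P (f :: 'a \<Rightarrow>\<^sub>0 'b::comm_monoid_add)"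
proof -
  have "P (\<Sum>u\<in>A. Poly_Mapping.single u (Poly_Mapping.lookup f u))" if "finite A" for A
    using that
  proof (induction A)
    case empty
    then show ?case using single[of undefined 0] by simp
  qed (simp add: single add)
  from this[OF finite_keys] show ?thesis
    by (subst mpol_eq_sum_terms)
qed

lemma keys_xmon_mult:
  "Poly_Mapping.keys (xmon u * f :: ('n, 'k::comm_ring_1) mpol) = (+) u ` Poly_Mapping.keys f"
  and lookup_xmon_mult_add [simp]:
  "Poly_Mapping.lookup (xmon u * f :: ('n, 'k::comm_ring_1) mpol) (u + w) = Poly_Mapping.lookup f w"
proof -
  have *: "xmon u * f = (\<Sum>v\<in>Poly_Mapping.keys f. Poly_Mapping.single (u + v) (Poly_Mapping.lookup f v))"
    by (subst mpol_eq_sum_terms[of f]) (simp add: xmon_def sum_distrib_left mult_single)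
  have l: "Poly_Mapping.lookup (xmon u * f) (u + w) = Poly_Mapping.lookup f w" for w
    unfolding *
    by (auto simp: lookup_sum lookup_single when_def in_keys_iff sum.delta[OF finite_keys])
  then show "Poly_Mapping.lookup (xmon u * f) (u + w) = Poly_Mapping.lookup f w" .
  have "Poly_Mapping.keys (xmon u * f) \<subseteq> (+) u ` Poly_Mapping.keys f"
    unfolding * by (rule subset_trans[OF keys_sum]) (auto split: if_splits)
  then show "Poly_Mapping.keys (xmon u * f) = (+) u ` Poly_Mapping.keys f"
    by (auto simp: in_keys_iff l)
qed

lemma keys_xmon [simp]: "Poly_Mapping.keys (xmon u :: ('n, 'k::zero_neq_one) mpol) = {u}"
  by (simp add: xmon_def)

lemma lookup_const_mult:
  "Poly_Mapping.lookup (Poly_Mapping.single 0 c * f) v = c * Poly_Mapping.lookup f v"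
  by (simp add: map.rep_eq when_def flip: mult_map_scale_conv_mult)

lemma xmon_dvd_iff:
  "(xmon v :: ('n, 'k::comm_ring_1) mpol) dvd xmon u \<longleftrightarrow> (\<exists>t. u = v + t)"
proof
  assume "(xmon v :: ('n, 'k) mpol) dvd xmon u"
  then obtain g :: "('n, 'k) mpol" where "xmon u = xmon v * g" by (auto simp: dvd_def)
  then have "{u} = (+) v ` Poly_Mapping.keys g" by (metis keys_xmon keys_xmon_mult)
  then show "\<exists>t. u = v + t" by auto
next
  assume "\<exists>t. u = v + t"
  then obtain t where "u = v + t" ..
  then have "(xmon u :: ('n, 'k) mpol) = xmon v * xmon t"
    by (simp add: xmon_def mult_single)
  then show "(xmon v :: ('n, 'k) mpol) dvd xmon u" by simp
qed

lemma mdeg_add [simp]: "mdeg (u + v) = mdeg u + mdeg v"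
  by (simp add: mdeg_def lookup_add sum.distrib)

lemma mdeg_var [simp]: "mdeg (Poly_Mapping.single i (Suc 0)) = 1"
  by (simp add: mdeg_def lookup_single when_def)

lemma mdeg_zero [simp]: "mdeg 0 = 0"
  by (simp add: mdeg_def)

lemma mdeg_eq_0_iff [simp]: "mdeg u = 0 \<longleftrightarrow> u = 0"
  by (simp add: mdeg_def poly_mapping_eq_iff fun_eq_iff)

lemma mdeg_pos_iff [simp]: "0 < mdeg u \<longleftrightarrow> u \<noteq> 0"
  using mdeg_eq_0_iff[of u] by linarith

lemma expo_split_var: "i \<in> supp u \<Longrightarrow> var_expo i + (u - var_expo i) = u"
  by (rule poly_mapping_eqI)
    (auto simp: lookup_add lookup_minus lookup_single when_def in_keys_iff)

lemma add_diff_var: "i \<in> supp u \<Longrightarrow> u + v - var_expo i = (u - var_expo i) + v"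
  by (rule poly_mapping_eqI)
    (auto simp: lookup_add lookup_minus lookup_single when_def in_keys_iff)

lemma finite_mdeg_le: "finite {u :: 'n::finite expo. mdeg u \<le> d}"
proof -
  have "finite {f :: 'n \<Rightarrow> nat. \<forall>i. (i \<in> UNIV \<longrightarrow> f i \<in> {..d}) \<and> (i \<notin> UNIV \<longrightarrow> f i = 0)}"
    by (rule finite_set_of_finite_funs) auto
  then have "finite {f :: 'n \<Rightarrow> nat. \<forall>i. f i \<le> d}" by simp
  moreover have "Poly_Mapping.lookup u i \<le> mdeg u" for u :: "'n expo" and i
    unfolding mdeg_def by (rule member_le_sum) auto
  then have "Poly_Mapping.lookup ` {u :: 'n expo. mdeg u \<le> d} \<subseteq> {f. \<forall>i. f i \<le> d}"
    by clarify (meson order_trans)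
  ultimately have "finite (Poly_Mapping.lookup ` {u :: 'n expo. mdeg u \<le> d})"
    by (rule rev_finite_subset)
  then show ?thesis
    by (rule finite_imageD) (simp add: inj_on_def poly_mapping.lookup_inject)
qed

definition up_closed :: "'n expo set \<Rightarrow> bool"
  where "up_closed U \<longleftrightarrow> (\<forall>u\<in>U. \<forall>t. u + t \<in> U)"

definition multiples :: "'n expo set \<Rightarrow> 'n expo set"
  where "multiples B = {u + t | u t. u \<in> B}"

lemma up_closed_multiples: "up_closed (multiples B)"
  by (auto simp: up_closed_def multiples_def) (metis add.assoc)

text \<open>
  Polynomials supported in \<open>U\<close>. Monomial ideals are the sets of this form with \<open>U\<close> closed under
  multiplication by monomials, so that questions about them become questions about sets of
  exponent vectors.
\<close>

definition supported_in :: "'n expo set \<Rightarrow> ('n, 'k::zero) mpol set"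
  where "supported_in U = {f. Poly_Mapping.keys f \<subseteq> U}"

lemma supported_in_0 [simp]: "0 \<in> supported_in U"
  and supported_in_UNIV [simp]: "supported_in UNIV = UNIV"
  and supported_in_empty [simp]: "supported_in {} = {0}"
  by (auto simp: supported_in_def)

lemma xmon_supported_in_iff [simp]:
  "(xmon u :: ('n, 'k::zero_neq_one) mpol) \<in> supported_in U \<longleftrightarrow> u \<in> U"
  by (simp add: supported_in_def)

lemma supported_in_iff_lookup:
  "f \<in> supported_in U \<longleftrightarrow> (\<forall>u. u \<notin> U \<longrightarrow> Poly_Mapping.lookup f u = 0)"
  by (auto simp: supported_in_def in_keys_iff)

lemma supported_in_add:
  "f \<in> supported_in U \<Longrightarrow> g \<in> supported_in U \<Longrightarrow> f + g \<in> supported_in U"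
  by (simp add: supported_in_iff_lookup lookup_add)

lemma supported_in_diff:
  "f \<in> supported_in U \<Longrightarrow> g \<in> supported_in U \<Longrightarrow>
    (f - g :: ('n, 'k::ab_group_add) mpol) \<in> supported_in U"
  by (simp add: supported_in_iff_lookup lookup_minus)

lemma supported_in_sum:
  "(\<And>x. x \<in> A \<Longrightarrow> f x \<in> supported_in U) \<Longrightarrow> sum f A \<in> supported_in U"
  by (simp add: supported_in_iff_lookup lookup_sum)

lemma supported_in_mono: "U \<subseteq> V \<Longrightarrow> f \<in> supported_in U \<Longrightarrow> f \<in> supported_in V"
  by (auto simp: supported_in_def)

lemma supported_in_mult:
  assumes "up_closed U" "f \<in> supported_in U"
  shows "g * f \<in> supported_in U" and "f * g \<in> supported_in U"
proof -
  have "Poly_Mapping.keys (g * f) \<subseteq> U"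
    using keys_mult[of g f] assms
    by (auto simp: supported_in_def up_closed_def subset_iff) (metis add.commute)
  then show "g * f \<in> supported_in U" by (simp add: supported_in_def)
  have "Poly_Mapping.keys (f * g) \<subseteq> U"
    using keys_mult[of f g] assms
    by (auto simp: supported_in_def up_closed_def subset_iff)
  then show "f * g \<in> supported_in U" by (simp add: supported_in_def)
qed

lemma xmon_mult_supported_in_iff:
  "(xmon u * f :: ('n, 'k::comm_ring_1) mpol) \<in> supported_in U \<longleftrightarrow> f \<in> supported_in {w. u + w \<in> U}"
  by (auto simp: supported_in_def keys_xmon_mult)

lemma ideal_module: "module ((*) :: 'a::comm_ring_1 \<Rightarrow> 'a \<Rightarrow> 'a)"
  by unfold_locales (simp_all add: algebra_simps)

lemma ideal_gen_subset:
  assumes "\<And>f. f \<in> F \<Longrightarrow> f \<in> J" and "0 \<in> J" and "\<And>f g. f \<in> J \<Longrightarrow> g \<in> J \<Longrightarrow> f + g \<in> J"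
    and "\<And>c f. f \<in> J \<Longrightarrow> c * f \<in> J"
  shows "ideal_gen F \<subseteq> J"
  unfolding ideal_gen_def
  by (rule module.span_minimal[OF ideal_module])
    (use assms in \<open>auto simp: module.subspace_def[OF ideal_module]\<close>)

lemma ideal_gen_base: "f \<in> F \<Longrightarrow> f \<in> ideal_gen F"
  and ideal_gen_mult: "f \<in> ideal_gen F \<Longrightarrow> c * f \<in> ideal_gen F"
  and ideal_gen_add: "f \<in> ideal_gen F \<Longrightarrow> g \<in> ideal_gen F \<Longrightarrow> f + g \<in> ideal_gen F"
  and ideal_gen_0 [simp]: "0 \<in> ideal_gen F"
  unfolding ideal_gen_def
  by (simp_all add: module.span_base[OF ideal_module] module.span_scale[OF ideal_module]
      module.span_add[OF ideal_module] module.span_zero[OF ideal_module])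

lemma ideal_gen_subset_ideal_gen:
  assumes "F \<subseteq> ideal_gen G"
  shows "ideal_gen F \<subseteq> ideal_gen G"
  by (rule ideal_gen_subset) (use assms in \<open>auto simp: ideal_gen_add ideal_gen_mult\<close>)

lemma ideal_gen_subset_supported_in:
  assumes "up_closed U" "\<And>f. f \<in> F \<Longrightarrow> f \<in> supported_in U"
  shows "ideal_gen F \<subseteq> supported_in U"
  by (rule ideal_gen_subset) (simp_all add: assms supported_in_add supported_in_mult)

lemma ideal_gen_sum: "(\<And>x. x \<in> A \<Longrightarrow> f x \<in> ideal_gen F) \<Longrightarrow> sum f A \<in> ideal_gen F"
  unfolding ideal_gen_def by (rule module.span_sum[OF ideal_module])

lemma ideal_gen_xmon:
  "ideal_gen (xmon ` B) = (supported_in (multiples B) :: ('n, 'k::comm_ring_1) mpol set)"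
proof
  show "ideal_gen (xmon ` B) \<subseteq> (supported_in (multiples B) :: ('n, 'k) mpol set)"
  proof (rule ideal_gen_subset_supported_in[OF up_closed_multiples])
    fix f :: "('n, 'k) mpol" assume "f \<in> xmon ` B"
    then show "f \<in> supported_in (multiples B)"
      by (auto simp: multiples_def) (metis add.right_neutral)
  qed
  show "(supported_in (multiples B) :: ('n, 'k) mpol set) \<subseteq> ideal_gen (xmon ` B)"
  proof
    fix f :: "('n, 'k) mpol" assume f: "f \<in> supported_in (multiples B)"
    have "Poly_Mapping.single u c \<in> ideal_gen (xmon ` B)" if "u \<in> multiples B" for u and c :: 'k
    proof -
      from that obtain b t where "b \<in> B" "u = b + t" by (auto simp: multiples_def)
      then have "Poly_Mapping.single u c = Poly_Mapping.single t c * xmon b"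
        by (simp add: xmon_def mult_single add.commute)
      then show ?thesis using \<open>b \<in> B\<close> by (simp add: ideal_gen_base ideal_gen_mult)
    qed
    then show "f \<in> ideal_gen (xmon ` B)"
      using f unfolding supported_in_def
      by (subst mpol_eq_sum_terms) (rule ideal_gen_sum, blast)
  qed
qed

lemma monomial_ideal_iff:
  "monomial_ideal (I :: ('n, 'k::comm_ring_1) mpol set) \<longleftrightarrow> (\<exists>U. up_closed U \<and> I = supported_in U)"
proof
  assume "monomial_ideal I"
  then show "\<exists>U. up_closed U \<and> I = supported_in U"
    unfolding monomial_ideal_def ideal_gen_xmon by (metis up_closed_multiples)
next
  assume "\<exists>U. up_closed U \<and> I = supported_in U"
  then obtain U where U: "up_closed U" "I = supported_in U" by blast
  then have "multiples U = U"
    by (auto simp: multiples_def up_closed_def) (metis add.right_neutral)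
  then show "monomial_ideal I"
    unfolding monomial_ideal_def ideal_gen_xmon using U by (intro exI[of _ U]) simp
qed

section \<open>Acyclicity of a resolution modulo monomial ideals\<close>

lemma homogeneous_of_degree_iff:
  "homogeneous_of_degree j f \<longleftrightarrow> f \<in> supported_in {u. int (mdeg u) = j}"
  by (auto simp: homogeneous_of_degree_def supported_in_def)

lemma homogeneous_of_degree_mult:
  fixes f g :: "('n::finite, 'k::comm_ring_1) mpol"
  assumes "homogeneous_of_degree a f" "homogeneous_of_degree b g"
  shows "homogeneous_of_degree (a + b) (f * g)"
  using assms keys_mult[of f g] by (fastforce simp: homogeneous_of_degree_def)

definition hom_component :: "int \<Rightarrow> ('n::finite, 'k::zero) mpol \<Rightarrow> ('n, 'k) mpol"
  where "hom_component j f = Poly_Mapping.mapp (\<lambda>u c. if int (mdeg u) = j then c else 0) f"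

lemma lookup_hom_component:
  "Poly_Mapping.lookup (hom_component j f) u =
    (if int (mdeg u) = j then Poly_Mapping.lookup f u else 0)"
  by (auto simp: hom_component_def lookup_mapp when_def in_keys_iff)

lemma homogeneous_hom_component: "homogeneous_of_degree j (hom_component j f)"
  by (auto simp: homogeneous_of_degree_def in_keys_iff lookup_hom_component split: if_splits)

lemma hom_component_id: "homogeneous_of_degree j f \<Longrightarrow> hom_component j f = f"
  by (rule poly_mapping_eqI)
    (auto simp: homogeneous_of_degree_def in_keys_iff lookup_hom_component)

lemma hom_component_sum: "hom_component j (sum f A) = (\<Sum>x\<in>A. hom_component j (f x))"
  by (rule poly_mapping_eqI) (simp add: lookup_sum lookup_hom_component)

lemma hom_component_mult:
  fixes f g :: "('n::finite, 'k::comm_ring_1) mpol"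
  assumes g: "homogeneous_of_degree b g"
  shows "hom_component j (f * g) = hom_component (j - b) f * g"
proof -
  define r where "r = f - hom_component (j - b) f"
  have r: "int (mdeg u) \<noteq> j - b" if "u \<in> Poly_Mapping.keys r" for u
    using that by (auto simp: r_def in_keys_iff lookup_minus lookup_hom_component)
  have "int (mdeg u) \<noteq> j" if "u \<in> Poly_Mapping.keys (r * g)" for u
    using that keys_mult[of r g] r g by (fastforce simp: homogeneous_of_degree_def)
  then have r0: "Poly_Mapping.lookup (r * g) u = 0" if "int (mdeg u) = j" for u
    using that by (auto simp: in_keys_iff)
  have h: "homogeneous_of_degree j (hom_component (j - b) f * g)"
    using homogeneous_of_degree_mult[OF homogeneous_hom_component g, of "j - b" f] by simp
  then have h0: "Poly_Mapping.lookup (hom_component (j - b) f * g) u = 0" if "int (mdeg u) \<noteq> j" for u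
    using that by (auto simp: homogeneous_of_degree_def in_keys_iff)
  have "f * g = hom_component (j - b) f * g + r * g"
    by (simp add: r_def algebra_simps)
  then show ?thesis
    by (intro poly_mapping_eqI) (simp add: lookup_hom_component lookup_add r0 h0)
qed

lemma cmod_deg_iff:
  "v \<in> cmod_deg P I i j \<longleftrightarrow>
    (\<forall>k < grank P i. v k \<in> I \<and> homogeneous_of_degree (j - gshift P i k) (v k)) \<and>
    (\<forall>k \<ge> grank P i. v k = 0)"
  by (auto simp: cmod_deg_def cmod_def)

lemma cmod_deg_imp_cmod: "v \<in> cmod_deg P I i j \<Longrightarrow> v \<in> cmod P UNIV i"
  by (simp add: cmod_deg_iff cmod_def)

lemma cmod_deg_add:
  "v \<in> cmod_deg P (supported_in U) i j \<Longrightarrow> w \<in> cmod_deg P (supported_in U) i j \<Longrightarrow>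
    (\<lambda>k. v k + w k) \<in> cmod_deg P (supported_in U) i j"
  by (simp add: cmod_deg_iff supported_in_add homogeneous_of_degree_iff)

lemma cmod_deg_diff:
  fixes P :: "('n::finite, 'k::comm_ring_1) free_cplx"
  shows "v \<in> cmod_deg P (supported_in U) i j \<Longrightarrow> w \<in> cmod_deg P (supported_in U) i j \<Longrightarrow>
    (\<lambda>k. v k - w k) \<in> cmod_deg P (supported_in U) i j"
  by (simp add: cmod_deg_iff supported_in_diff homogeneous_of_degree_iff)

lemma cmod_deg_mono:
  "U \<subseteq> V \<Longrightarrow> v \<in> cmod_deg P (supported_in U) i j \<Longrightarrow> v \<in> cmod_deg P (supported_in V) i j"
  by (auto simp: cmod_deg_iff intro: supported_in_mono)

lemma cmod_deg_xmon_mult: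
  fixes P :: "('n::finite, 'k::comm_ring_1) free_cplx"
  assumes v: "v \<in> cmod_deg P (supported_in V) i (j - int (mdeg u))"
    and uV: "\<And>w. w \<in> V \<Longrightarrow> u + w \<in> U"
  shows "(\<lambda>k. xmon u * v k) \<in> cmod_deg P (supported_in U) i j"
  unfolding cmod_deg_iff
proof (intro conjI allI impI)
  fix k assume "k < grank P i"
  then show "xmon u * v k \<in> supported_in U"
    and "homogeneous_of_degree (j - gshift P i k) (xmon u * v k)"
    using v uV by (auto simp: cmod_deg_iff supported_in_def homogeneous_of_degree_def keys_xmon_mult)
qed (use v in \<open>simp add: cmod_deg_iff\<close>)

declare cdiff.simps(2) [simp del]

lemmas cdiff_Suc = cdiff.simps(2)

lemma cdiff_Suc_beyond [simp]: "l \<ge> grank P i \<Longrightarrow> cdiff P (Suc i) v l = 0"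
  by (simp add: cdiff_Suc)

lemma cdiff_add: "cdiff P i (\<lambda>k. v k + w k) l = cdiff P i v l + cdiff P i w l"
  and cdiff_diff: "cdiff P i (\<lambda>k. v k - w k) l = cdiff P i v l - cdiff P i w l"
  and cdiff_mult: "cdiff P i (\<lambda>k. c * v k) l = c * cdiff P i v l"
  by (cases i; simp add: cdiff_Suc algebra_simps sum.distrib sum_subtractf sum_distrib_left)+

lemma cdiff_supported_in:
  fixes P :: "('n::finite, 'k::comm_ring_1) free_cplx"
  assumes "up_closed U" "v \<in> cmod P (supported_in U) i"
  shows "cdiff P i v l \<in> supported_in U"
  using assms by (cases i) (auto simp: cdiff_Suc cmod_def intro!: supported_in_sum supported_in_mult)

lemma cdiff_cmod_deg:
  fixes P :: "('n::finite, 'k::field) free_cplx"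
  assumes P: "graded_free_resolution_of_field P e"
    and U: "up_closed U" and v: "v \<in> cmod_deg P (supported_in U) (Suc i) j"
  shows "cdiff P (Suc i) v \<in> cmod_deg P (supported_in U) i j"
proof -
  have "cdiff P (Suc i) v l \<in> supported_in U" for l
    using U v by (intro cdiff_supported_in) (auto simp: cmod_deg_def)
  moreover have "homogeneous_of_degree (j - gshift P i l) (cdiff P (Suc i) v l)"
    if l: "l < grank P i" for l
  proof -
    have "homogeneous_of_degree (j - gshift P i l) (v k * gmat P i k l)"
      if k: "k < grank P (Suc i)" for k
      using homogeneous_of_degree_mult[of "j - gshift P (Suc i) k" "v k"
          "gshift P (Suc i) k - gshift P i l" "gmat P i k l"] P v k l
      by (simp add: graded_free_resolution_of_field_def cmod_deg_iff)
    then show ?thesis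
      using l by (auto simp: cdiff_Suc homogeneous_of_degree_iff intro: supported_in_sum)
  qed
  ultimately show ?thesis by (simp add: cmod_deg_iff)
qed

lemma cdiff_cdiff:
  fixes P :: "('n::finite, 'k::field) free_cplx"
  assumes P: "graded_free_resolution_of_field P e" and w: "w \<in> cmod P UNIV (Suc i)"
  shows "cdiff P i (cdiff P (Suc i) w) = (\<lambda>l. 0)"
proof (cases i)
  case (Suc i')
  then have "{v \<in> cmod P UNIV i. cdiff P i v = (\<lambda>l. 0)} = cdiff P (Suc i) ` cmod P UNIV (Suc i)"
    using P by (simp only: graded_free_resolution_of_field_def)
  then show ?thesis using w by blast
qed simp

text \<open>
  The matrices are homogeneous, so a homogeneous cycle that bounds already bounds the homogeneous
  component of the right degree. In homological degree \<open>0\<close> positivity of \<open>j\<close> replaces the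
  cycle condition: the augmentation only sees constants.
\<close>

lemma resolution_exact_deg:
  fixes P :: "('n::finite, 'k::field) free_cplx"
  assumes P: "graded_free_resolution_of_field P e"
    and v: "v \<in> cmod_deg P UNIV i j" and cycle: "cdiff P i v = (\<lambda>l. 0)" and "j > int i"
  shows "\<exists>w \<in> cmod_deg P UNIV (Suc i) j. cdiff P (Suc i) w = v"
proof -
  have "v \<in> cdiff P (Suc i) ` cmod P UNIV (Suc i)"
  proof (cases i)
    case 0
    have "Poly_Mapping.lookup (v k) 0 * e k = 0" if "k < grank P 0" for k
    proof (cases "e k = 0")
      case False
      then have "gshift P 0 k = 0"
        using P that by (simp add: graded_free_resolution_of_field_def)
      then have "homogeneous_of_degree j (v k)"
        using v that 0 by (auto simp: cmod_deg_iff)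
      then show ?thesis
        using \<open>j > int i\<close> by (force simp: homogeneous_of_degree_def in_keys_iff)
    qed simp
    then have "augmentation P e v = 0" by (auto simp: augmentation_def intro!: sum.neutral)
    then show ?thesis
      using P 0 cmod_deg_imp_cmod[OF v] unfolding graded_free_resolution_of_field_def by auto
  next
    case (Suc i')
    then have "{v \<in> cmod P UNIV i. cdiff P i v = (\<lambda>l. 0)} = cdiff P (Suc i) ` cmod P UNIV (Suc i)"
      using P by (simp only: graded_free_resolution_of_field_def)
    then show ?thesis using cycle cmod_deg_imp_cmod[OF v] by blast
  qed
  then obtain w where w: "w \<in> cmod P UNIV (Suc i)" "v = cdiff P (Suc i) w" by blast
  define w' where "w' k = (if k < grank P (Suc i) then hom_component (j - gshift P (Suc i) k) (w k) else 0)" for k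
  have "w' \<in> cmod_deg P UNIV (Suc i) j"
    by (simp add: cmod_deg_iff w'_def homogeneous_hom_component)
  moreover have "cdiff P (Suc i) w' l = v l" for l
  proof (cases "l < grank P i")
    case True
    have "v l = hom_component (j - gshift P i l) (cdiff P (Suc i) w l)"
      using v True w(2) by (simp add: cmod_deg_iff hom_component_id)
    also have "\<dots> = (\<Sum>k < grank P (Suc i). hom_component (j - gshift P i l) (w k * gmat P i k l))"
      using True by (simp add: cdiff_Suc hom_component_sum)
    also have "\<dots> = (\<Sum>k < grank P (Suc i). w' k * gmat P i k l)"
    proof (rule sum.cong[OF refl])
      fix k assume "k \<in> {..<grank P (Suc i)}"
      then show "hom_component (j - gshift P i l) (w k * gmat P i k l) = w' k * gmat P i k l"
        using P True
          hom_component_mult[of "gshift P (Suc i) k - gshift P i l" "gmat P i k l" "j - gshift P i l" "w k"]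
        by (simp add: graded_free_resolution_of_field_def w'_def)
    qed
    finally show ?thesis using True by (simp add: cdiff_Suc)
  qed (use v in \<open>simp add: cdiff_Suc cmod_deg_iff\<close>)
  ultimately show ?thesis by blast
qed

text \<open>
  For \<open>W \<subseteq> U\<close> closed under multiples this says that \<open>H\<^sub>i(P \<otimes> J/J')\<^sub>j\<close> vanishes, where \<open>J\<close> and \<open>J'\<close>
  are the monomial ideals of \<open>U\<close> and \<open>W\<close>. Spelling it out with cycles modulo \<open>W\<close> avoids
  quotient modules.
\<close>

definition rel_acyclic ::
    "('n::finite, 'k::comm_ring_1) free_cplx \<Rightarrow> 'n expo set \<Rightarrow> 'n expo set \<Rightarrow> nat \<Rightarrow> int \<Rightarrow> bool"
  where "rel_acyclic P U W i j \<longleftrightarrow>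
    (\<forall>v \<in> cmod_deg P (supported_in U) i j. (\<forall>l. cdiff P i v l \<in> supported_in W) \<longrightarrow>
      (\<exists>w \<in> cmod_deg P (supported_in U) (Suc i) j.
         \<forall>k. v k - cdiff P (Suc i) w k \<in> supported_in W))"

lemma rel_acyclicE:
  assumes "rel_acyclic P U W i j" "v \<in> cmod_deg P (supported_in U) i j"
    "\<And>l. cdiff P i v l \<in> supported_in W"
  obtains w where "w \<in> cmod_deg P (supported_in U) (Suc i) j"
    "\<And>k. v k - cdiff P (Suc i) w k \<in> supported_in W"
  using assms unfolding rel_acyclic_def by blast

text \<open>The quotient of \<open>f\<close> by \<open>x\<^sup>u\<close>, discarding the terms that \<open>x\<^sup>u\<close> does not divide.\<close>

definition xmon_quotient :: "'n expo \<Rightarrow> ('n, 'k::zero) mpol \<Rightarrow> ('n, 'k) mpol"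
  where "xmon_quotient u f = Poly_Mapping.map_key ((+) u) f"

lemma keys_xmon_quotient: "Poly_Mapping.keys (xmon_quotient u f) = {w. u + w \<in> Poly_Mapping.keys f}"
  and lookup_xmon_quotient: "Poly_Mapping.lookup (xmon_quotient u f) w = Poly_Mapping.lookup f (u + w)"
  by (auto simp: xmon_quotient_def keys_map_key map_key.rep_eq)

lemma lookup_xmon_mult_nondvd:
  "u \<notin> range ((+) v) \<Longrightarrow> Poly_Mapping.lookup (xmon v * f :: ('n, 'k::comm_ring_1) mpol) u = 0"
  using keys_xmon_mult[of v f] by (auto simp: in_keys_iff set_eq_iff)

lemma remainder_supported_in:
  assumes "f \<in> supported_in (U \<union> range ((+) u))"
  shows "(f - xmon u * xmon_quotient u f :: ('n, 'k::comm_ring_1) mpol) \<in> supported_in U"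
  unfolding supported_in_iff_lookup
proof (intro allI impI)
  fix w assume "w \<notin> U"
  show "Poly_Mapping.lookup (f - xmon u * xmon_quotient u f) w = 0"
  proof (cases "w \<in> range ((+) u)")
    case True
    then show ?thesis by (auto simp: lookup_minus lookup_xmon_quotient)
  next
    case False
    then show ?thesis using assms \<open>w \<notin> U\<close>
      by (simp add: lookup_minus lookup_xmon_mult_nondvd supported_in_iff_lookup)
  qed
qed

lemma cmod_deg_xmon_quotient:
  fixes P :: "('n::finite, 'k::comm_ring_1) free_cplx"
  assumes "v \<in> cmod_deg P (supported_in U) i j"
  shows "(\<lambda>k. xmon_quotient u (v k)) \<in> cmod_deg P (supported_in UNIV) i (j - int (mdeg u))"
proof -
  have "xmon_quotient u (0 :: ('n, 'k) mpol) = 0"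
    by (simp add: xmon_quotient_def)
  then show ?thesis
    using assms by (fastforce simp: cmod_deg_iff homogeneous_of_degree_def keys_xmon_quotient)
qed

text \<open>
  This is the long exact sequence of
  \<open>0 \<rightarrow> S/J(-1) \<rightarrow> S/J \<rightarrow> S/(J + x\<^sub>aS) \<rightarrow> 0\<close> for the ideal \<open>J\<close> generated by the variables in
  \<open>A\<close>, read off on cycles: adjoining a variable costs one homological degree and one internal
  degree, so the region \<open>j > i\<close> is preserved.
\<close>

lemma rel_acyclic_variables:
  fixes P :: "('n::finite, 'k::field) free_cplx"
  assumes P: "graded_free_resolution_of_field P e" and "finite A" and "j > int i"
  shows "rel_acyclic P UNIV {w. supp w \<inter> A \<noteq> {}} i j"
  using \<open>finite A\<close> \<open>j > int i\<close>
proof (induction A arbitrary: i j)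
  case empty
  have "\<exists>w \<in> cmod_deg P UNIV (Suc i) j. cdiff P (Suc i) w = v"
    if "v \<in> cmod_deg P UNIV i j" "\<forall>l. cdiff P i v l = 0" for v
    using resolution_exact_deg[OF P that(1) _ empty] that(2) by (simp add: fun_eq_iff)
  then show ?case by (fastforce simp: rel_acyclic_def)
next
  case (insert a A)
  let ?W = "{w. supp w \<inter> A \<noteq> {}}" and ?W' = "{w. supp w \<inter> insert a A \<noteq> {}}"
  let ?x = "var_expo a"
  have W: "up_closed ?W"
    by (auto simp: up_closed_def in_keys_iff lookup_add disjoint_iff)
  have W': "w \<in> ?W' \<longleftrightarrow> w \<in> ?W \<union> range ((+) ?x)" for w
  proof -
    have "a \<in> supp w \<longleftrightarrow> w \<in> range ((+) ?x)"
      using expo_split_var[of a w] by (auto simp: image_iff in_keys_iff lookup_add) metis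
    then show ?thesis by auto
  qed
  have x_W: "?x + w \<in> ?W \<longleftrightarrow> w \<in> ?W" for w
    using insert.hyps by (auto simp: disjoint_iff in_keys_iff lookup_add lookup_single when_def)
  have x_cancel: "xmon ?x * f \<in> supported_in ?W \<longleftrightarrow> f \<in> supported_in ?W" for f :: "('n, 'k) mpol"
    by (simp only: xmon_mult_supported_in_iff x_W Collect_mem_eq)
  have W_W': "f \<in> supported_in ?W'" if "f - xmon ?x * g \<in> supported_in ?W" for f g :: "('n, 'k) mpol"
  proof -
    have "xmon ?x * g \<in> supported_in ?W'"
    proof -
      have "{w. ?x + w \<in> ?W'} = UNIV" unfolding W' by blast
      then show ?thesis by (simp only: xmon_mult_supported_in_iff supported_in_UNIV UNIV_I)
    qed
    from supported_in_add[OF supported_in_mono[OF _ that] this] show ?thesis by auto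
  qed
  show ?case
    unfolding rel_acyclic_def
  proof (intro ballI impI)
    fix v assume v: "v \<in> cmod_deg P (supported_in UNIV) i j"
      and dv: "\<forall>l. cdiff P i v l \<in> supported_in ?W'"
    obtain z where z: "z \<in> cmod_deg P (supported_in UNIV) i (j - 1)"
      and dz: "\<And>l. cdiff P i v l - xmon ?x * cdiff P i z l \<in> supported_in ?W"
    proof (cases i)
      case 0
      show ?thesis by (rule that[of "\<lambda>k. 0"]) (simp_all add: 0 cmod_deg_iff homogeneous_of_degree_def)
    next
      case (Suc i')
      \<comment> \<open>The class of \<open>y\<close> is the image of \<open>v\<close> under the connecting homomorphism. It vanishes by
        the induction hypothesis one step down in both degrees.\<close>
      define y where "y l = xmon_quotient ?x (cdiff P i v l)" for l
      have y: "y \<in> cmod_deg P (supported_in UNIV) i' (j - 1)"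
        using cmod_deg_xmon_quotient[OF cdiff_cmod_deg[OF P _ v[unfolded Suc]], of ?x]
        by (simp add: y_def[abs_def] Suc up_closed_def)
      have b: "cdiff P i v l - xmon ?x * y l \<in> supported_in ?W" for l
        unfolding y_def by (rule remainder_supported_in) (use dv W' in \<open>auto simp: supported_in_def\<close>)
      have "cdiff P i' y l \<in> supported_in ?W" for l
      proof -
        have "cdiff P i' (\<lambda>l. cdiff P i v l - xmon ?x * y l) l = - (xmon ?x * cdiff P i' y l)"
          using cdiff_cdiff[OF P, of v i'] cmod_deg_imp_cmod[OF v]
          by (simp add: cdiff_diff cdiff_mult Suc)
        moreover have "cdiff P i' (\<lambda>l. cdiff P i v l - xmon ?x * y l) l \<in> supported_in ?W"
          using b y v by (intro cdiff_supported_in[OF W]) (auto simp: cmod_def Suc cmod_deg_iff)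
        ultimately have "xmon ?x * cdiff P i' y l \<in> supported_in ?W"
          using supported_in_diff[OF supported_in_0] by fastforce
        then show ?thesis by (simp only: x_cancel)
      qed
      with insert.IH[of i' "j - 1"] y insert.prems Suc obtain z
        where "z \<in> cmod_deg P (supported_in UNIV) (Suc i') (j - 1)"
          and z: "\<And>k. y k - cdiff P (Suc i') z k \<in> supported_in ?W"
        by (auto elim!: rel_acyclicE)
      moreover have "cdiff P i v l - xmon ?x * cdiff P i z l \<in> supported_in ?W" for l
        using supported_in_add[OF b[of l] supported_in_mult(1)[OF W z[of l], of "xmon ?x"]]
        by (simp add: Suc algebra_simps)
      ultimately show ?thesis using that Suc by blast
    qed
    \<comment> \<open>Subtracting a multiple of \<open>x\<^sub>a\<close> turns \<open>v\<close> into a cycle modulo the smaller ideal.\<close>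
    define v' where "v' k = v k - xmon ?x * z k" for k
    have "v' \<in> cmod_deg P (supported_in UNIV) i j"
      unfolding v'_def[abs_def]
      using v cmod_deg_xmon_mult[of z P UNIV i j ?x UNIV] z by (intro cmod_deg_diff) simp_all
    moreover have "cdiff P i v' l \<in> supported_in ?W" for l
      using dz[of l] by (simp add: v'_def[abs_def] cdiff_diff cdiff_mult)
    ultimately obtain w where w: "w \<in> cmod_deg P (supported_in UNIV) (Suc i) j"
      and "\<And>k. v' k - cdiff P (Suc i) w k \<in> supported_in ?W"
      using insert.IH[of i j] insert.prems by (auto elim!: rel_acyclicE)
    then have "v k - cdiff P (Suc i) w k \<in> supported_in ?W'" for k
      using W_W'[of "v k - cdiff P (Suc i) w k" "z k"] by (simp add: v'_def algebra_simps)
    with w show "\<exists>w \<in> cmod_deg P (supported_in UNIV) (Suc i) j.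
        \<forall>k. v k - cdiff P (Suc i) w k \<in> supported_in ?W'" by blast
  qed
qed

text \<open>
  \<open>H\<^sub>i(P \<otimes> J)\<^sub>j = 0\<close> for \<open>j - i > d\<close>; as \<open>P\<close> resolves the residue field, this means that the
  monomial ideal \<open>J\<close> of \<open>U\<close> has regularity at most \<open>d\<close>.
\<close>

definition regularity_le ::
    "('n::finite, 'k::comm_ring_1) free_cplx \<Rightarrow> 'n expo set \<Rightarrow> nat \<Rightarrow> bool"
  where "regularity_le P U d \<longleftrightarrow> (\<forall>i j. j > int i + int d \<longrightarrow> rel_acyclic P U {} i j)"

text \<open>
  If \<open>J : x\<^sup>u\<close> is generated by variables, then \<open>(J + x\<^sup>uS)/J\<close> is a shifted copy of a polynomial ring
  modulo variables, with regularity \<open>deg u\<close>.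
\<close>

lemma regularity_le_adjoin:
  fixes P :: "('n::finite, 'k::field) free_cplx"
  assumes P: "graded_free_resolution_of_field P e" and U: "up_closed U"
    and reg: "regularity_le P U d" and "mdeg u \<le> d"
    and colon: "\<And>w. u + w \<in> U \<longleftrightarrow> supp w \<inter> A \<noteq> {}"
  shows "regularity_le P (U \<union> range ((+) u)) d"
  unfolding regularity_le_def rel_acyclic_def
proof (intro allI impI ballI)
  fix i j v
  let ?U' = "U \<union> range ((+) u)" and ?W = "{w. supp w \<inter> A \<noteq> {}}"
  assume j: "int i + int d < j" and v: "v \<in> cmod_deg P (supported_in ?U') i j"
    and dv: "\<forall>l. cdiff P i v l \<in> supported_in {}"
  have colon': "xmon u * f \<in> supported_in U \<longleftrightarrow> f \<in> supported_in ?W" for f :: "('n, 'k) mpol"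
    by (simp only: xmon_mult_supported_in_iff colon)
  \<comment> \<open>In \<open>v = x\<^sup>uq + b\<close> the part \<open>q\<close> is a cycle modulo the colon ideal, hence a boundary \<open>dw\<close> modulo
    it; then \<open>r = v - d(x\<^sup>uw)\<close> is a cycle with entries in the ideal of \<open>U\<close>.\<close>
  define q where "q k = xmon_quotient u (v k)" for k
  define b where "b k = v k - xmon u * q k" for k
  have q: "q \<in> cmod_deg P (supported_in UNIV) i (j - int (mdeg u))"
    unfolding q_def[abs_def] by (rule cmod_deg_xmon_quotient[OF v])
  have b: "b k \<in> supported_in U" for k
    unfolding b_def q_def
    using v by (intro remainder_supported_in) (cases "k < grank P i"; simp add: cmod_deg_iff)
  have "cdiff P i q l \<in> supported_in ?W" for l
  proof -
    have "cdiff P i b l \<in> supported_in U"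
      using b q v by (intro cdiff_supported_in[OF U]) (auto simp: cmod_def cmod_deg_iff b_def)
    moreover have "cdiff P i b l = - (xmon u * cdiff P i q l)"
      using dv by (simp add: b_def[abs_def] cdiff_diff cdiff_mult)
    ultimately have "xmon u * cdiff P i q l \<in> supported_in U"
      using supported_in_diff[OF supported_in_0] by fastforce
    then show ?thesis by (simp only: colon')
  qed
  moreover have "rel_acyclic P UNIV ?W i (j - int (mdeg u))"
    using j \<open>mdeg u \<le> d\<close> by (intro rel_acyclic_variables[OF P]) auto
  ultimately obtain w where w: "w \<in> cmod_deg P (supported_in UNIV) (Suc i) (j - int (mdeg u))"
    and qw: "\<And>k. q k - cdiff P (Suc i) w k \<in> supported_in ?W"
    using q by (auto elim!: rel_acyclicE)
  define w' where "w' k = xmon u * w k" for k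
  have w': "w' \<in> cmod_deg P (supported_in ?U') (Suc i) j"
    unfolding w'_def[abs_def] by (rule cmod_deg_xmon_mult[OF w]) simp
  have up: "up_closed ?U'"
    using U by (auto simp: up_closed_def add.assoc)
  have dw': "cdiff P (Suc i) w' \<in> cmod_deg P (supported_in ?U') i j"
    by (rule cdiff_cmod_deg[OF P up w'])
  define r where "r k = v k - cdiff P (Suc i) w' k" for k
  have "r k \<in> supported_in U" for k
  proof -
    have "r k = b k + xmon u * (q k - cdiff P (Suc i) w k)"
      by (simp add: r_def b_def w'_def[abs_def] cdiff_mult algebra_simps)
    then show ?thesis using b qw colon' by (simp add: supported_in_add)
  qed
  then have "r \<in> cmod_deg P (supported_in U) i j"
    using cmod_deg_diff[OF v dw'] unfolding r_def[symmetric] by (simp add: cmod_deg_iff)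
  moreover have "cdiff P i r l \<in> supported_in {}" for l
    using dv cdiff_cdiff[OF P cmod_deg_imp_cmod[OF w']]
    by (simp add: r_def[abs_def] cdiff_diff)
  moreover have "rel_acyclic P U {} i j"
    using reg j by (simp add: regularity_le_def)
  ultimately obtain w2 where w2: "w2 \<in> cmod_deg P (supported_in U) (Suc i) j"
    and r: "\<And>k. r k - cdiff P (Suc i) w2 k \<in> supported_in {}"
    by (auto elim!: rel_acyclicE)
  have "(\<lambda>k. w' k + w2 k) \<in> cmod_deg P (supported_in ?U') (Suc i) j"
    using w' cmod_deg_mono[OF _ w2] by (intro cmod_deg_add) auto
  moreover have "v k - cdiff P (Suc i) (\<lambda>k. w' k + w2 k) k \<in> supported_in {}" for k
    using r[of k] by (simp add: r_def cdiff_add algebra_simps)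
  ultimately show "\<exists>w \<in> cmod_deg P (supported_in ?U') (Suc i) j.
      \<forall>k. v k - cdiff P (Suc i) w k \<in> supported_in {}" by blast
qed

section \<open>Stable ideals\<close>

definition stable_expos :: "'n::linorder expo set \<Rightarrow> bool"
  where "stable_expos U \<longleftrightarrow>
    (\<forall>u \<in> U. u \<noteq> 0 \<longrightarrow> (\<forall>i < Max (supp u). var_expo i + (u - var_expo (Max (supp u))) \<in> U))"

definition strongly_stable_expos :: "'n::linorder expo set \<Rightarrow> bool"
  where "strongly_stable_expos U \<longleftrightarrow>
    (\<forall>u \<in> U. \<forall>j \<in> supp u. \<forall>i < j. var_expo i + (u - var_expo j) \<in> U)"

lemma stable_ideal_supported_in:
  "up_closed U \<Longrightarrow>
    stable_ideal (supported_in U :: ('n::linorder, 'k::comm_ring_1) mpol set) \<longleftrightarrow> stable_expos U"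
  and strongly_stable_ideal_supported_in:
  "up_closed U \<Longrightarrow>
    strongly_stable_ideal (supported_in U :: ('n::linorder, 'k::comm_ring_1) mpol set) \<longleftrightarrow>
    strongly_stable_expos U"
  by (auto simp: stable_ideal_def strongly_stable_ideal_def stable_expos_def
      strongly_stable_expos_def monomial_ideal_iff)

lemma strongly_stable_imp_stable:
  assumes "strongly_stable_expos U"
  shows "stable_expos U"
proof -
  have "Max (supp u) \<in> supp u" if "u \<noteq> 0" for u :: "'a expo"
    using that by (intro Max_in) (auto simp: poly_mapping_eq_iff fun_eq_iff in_keys_iff set_eq_iff)
  then show ?thesis using assms by (simp add: strongly_stable_expos_def stable_expos_def)
qed

lemma Max_supp:
  assumes "k \<in> supp (u :: 'n::linorder expo)"
  shows "Max (supp u) \<in> supp u" and "k \<le> Max (supp u)"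
  using assms by (auto intro: Max_in)

lemma rel_acyclic_empty:
  fixes P :: "('n::finite, 'k::comm_ring_1) free_cplx"
  shows "rel_acyclic P {} {} i j"
  unfolding rel_acyclic_def
proof (intro impI ballI)
  fix v assume "v \<in> cmod_deg P (supported_in {}) i j"
  then have "v k = 0" for k by (cases "k < grank P i") (auto simp: cmod_deg_iff)
  then show "\<exists>w \<in> cmod_deg P (supported_in {}) (Suc i) j.
      \<forall>k. v k - cdiff P (Suc i) w k \<in> supported_in {}"
    by (intro bexI[of _ "\<lambda>k. 0"]) (auto simp: cdiff_Suc cmod_deg_iff homogeneous_of_degree_def)
qed

text \<open>
  Add the monomials of degree \<open>d\<close> in lexicographically decreasing order. If \<open>bw\<close> is a
  multiple of an earlier monomial \<open>y\<close> and \<open>l\<close> is the first place where \<open>b\<close> and \<open>y\<close> differ, then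
  \<open>x\<^sub>l\<close> divides \<open>w\<close>; and \<open>l < max b\<close>, since \<open>b\<close> and \<open>y\<close> have the same degree. Conversely stability
  makes \<open>x\<^sub>ib\<close> a multiple of the earlier monomial \<open>x\<^sub>i(b/x\<^sub>m)\<close> for each \<open>i < m = max b\<close>.
\<close>

lemma lex_colon:
  fixes V :: "'n::{finite,linorder} expo set"
  assumes V: "stable_expos V" and b: "b \<in> V" "mdeg b = d"
  shows "b + w \<in> multiples {y \<in> V. mdeg y = d \<and> b < y} \<longleftrightarrow> supp w \<inter> {i. \<exists>k \<in> supp b. i < k} \<noteq> {}"
    (is "?L \<longleftrightarrow> ?R")
proof
  assume ?L
  then obtain y t where y: "y \<in> V" "mdeg y = d" "b < y" and t: "b + w = y + t"
    by (auto simp: multiples_def)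
  from \<open>b < y\<close> obtain l where l: "Poly_Mapping.lookup b l < Poly_Mapping.lookup y l"
    and below: "\<And>k. k < l \<Longrightarrow> Poly_Mapping.lookup b k = Poly_Mapping.lookup y k"
    by (auto simp: less_poly_mapping.rep_eq less_fun_def)
  have "Poly_Mapping.lookup (b + w) l = Poly_Mapping.lookup (y + t) l"
    using t by simp
  then have "l \<in> supp w"
    using l by (auto simp: lookup_add in_keys_iff)
  moreover have "\<exists>k \<in> supp b. l < k"
  proof (rule ccontr)
    assume above: "\<not> (\<exists>k \<in> supp b. l < k)"
    have "Poly_Mapping.lookup b k \<le> Poly_Mapping.lookup y k" for k
      using above below[of k] l by (cases k l rule: linorder_cases) (auto simp: in_keys_iff)
    then have "mdeg b < mdeg y"
      unfolding mdeg_def using l by (intro sum_strict_mono_ex1) auto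
    then show False using b y by simp
  qed
  ultimately show ?R by blast
next
  assume ?R
  then obtain i k where ik: "i \<in> supp w" "k \<in> supp b" "i < k" by blast
  define m where "m = Max (supp b)"
  have m: "m \<in> supp b" "i < m"
    using Max_supp[OF ik(2)] ik(3) by (auto simp: m_def)
  define b' w' where "b' = b - var_expo m" and "w' = w - var_expo i"
  define y where "y = var_expo i + b'"
  have b_eq: "var_expo m + b' = b" and w_eq: "var_expo i + w' = w"
    using expo_split_var[OF m(1)] expo_split_var[OF ik(1)] by (simp_all add: b'_def w'_def)
  have "b \<noteq> 0" using m by auto
  then have "y \<in> V"
    using V b m by (auto simp: stable_expos_def y_def b'_def m_def)
  moreover have "mdeg y = d"
    using b(2) unfolding b_eq[symmetric] by (simp add: y_def)
  moreover have "b < y"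
    unfolding less_poly_mapping.rep_eq
    by (rule less_funI, rule exI[of _ i])
      (use m in \<open>auto simp: y_def b'_def lookup_add lookup_minus lookup_single when_def\<close>)
  moreover have "b + w = y + (var_expo m + w')"
  proof -
    have "b + w = (var_expo m + b') + (var_expo i + w')" by (simp only: b_eq w_eq)
    also have "\<dots> = y + (var_expo m + w')" by (simp only: y_def ac_simps)
    finally show ?thesis .
  qed
  ultimately show ?L by (auto simp: multiples_def)
qed

lemma regularity_le_stable_single_degree:
  fixes P :: "('n::{finite,linorder}, 'k::field) free_cplx"
  assumes P: "graded_free_resolution_of_field P e" and V: "stable_expos V"
  shows "regularity_le P (multiples {v \<in> V. mdeg v = d}) d"
proof -
  let ?G = "{v \<in> V. mdeg v = d}"
  have "finite ?G"
    by (rule finite_subset[OF _ finite_mdeg_le[of d]]) auto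
  have "B \<subseteq> ?G \<Longrightarrow> (\<forall>x \<in> B. \<forall>y \<in> ?G. x < y \<longrightarrow> y \<in> B) \<Longrightarrow> regularity_le P (multiples B) d"
    if "finite B" for B
    using that
  proof (induction B rule: finite_linorder_min_induct)
    case empty
    then show ?case by (simp add: multiples_def regularity_le_def rel_acyclic_empty)
  next
    case (insert b A)
    have A: "A = {y \<in> V. mdeg y = d \<and> b < y}"
        using insert.prems insert.hyps(2) by blast
    have "multiples (insert b A) = multiples A \<union> range ((+) b)"
      by (auto simp: multiples_def)
    moreover have "regularity_le P (multiples A \<union> range ((+) b)) d"
    proof (rule regularity_le_adjoin[OF P up_closed_multiples])
      show "regularity_le P (multiples A) d"
      proof (rule insert.IH)
        show "A \<subseteq> ?G" using insert.prems by simp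
        show "\<forall>x \<in> A. \<forall>y \<in> ?G. x < y \<longrightarrow> y \<in> A" unfolding A by auto
      qed
      show "b + w \<in> multiples A \<longleftrightarrow> supp w \<inter> {i. \<exists>k \<in> supp b. i < k} \<noteq> {}" for w
        unfolding A using insert.prems by (intro lex_colon[OF V]) auto
    qed (use insert.prems in auto)
    ultimately show ?case by simp
  qed
  from this[OF \<open>finite ?G\<close>] show ?thesis by blast
qed

text \<open>
  The monomials of \<open>V\<close> of degree less than \<open>d\<close> are adjoined by decreasing degree to the part of degree at
  least \<open>d\<close>. Each variable times such a monomial is already present, so each colon ideal is the
  maximal ideal.
\<close>

lemma regularity_le_truncation:
  fixes P :: "('n::{finite,linorder}, 'k::field) free_cplx"
  assumes P: "graded_free_resolution_of_field P e" and V: "up_closed V"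
    and reg: "regularity_le P {v \<in> V. d \<le> mdeg v} d"
  shows "regularity_le P V d"
proof -
  let ?T = "{v \<in> V. d \<le> mdeg v}" and ?L = "{v \<in> V. mdeg v < d}"
  have "finite ?L"
    by (rule finite_subset[OF _ finite_mdeg_le[of d]]) auto
  have "B \<subseteq> ?L \<Longrightarrow> (\<forall>x \<in> B. \<forall>y \<in> ?L. mdeg x < mdeg y \<longrightarrow> y \<in> B) \<Longrightarrow>
      regularity_le P (?T \<union> B) d" if "finite B" for B
    using that
  proof (induction B rule: finite_ranking_induct[where f = "\<lambda>u. - int (mdeg u)"])
    case empty
    then show ?case using reg by simp
  next
    case (insert b A)
    show ?case
    proof (cases "b \<in> A")
      case True
      then have "insert b A = A" by (rule insert_absorb)
      then show ?thesis using insert.IH insert.prems by (simp only:)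
    next
      case False
      have b: "b \<in> V" "mdeg b < d" and A: "A \<subseteq> ?L"
        using insert.prems(1) by auto
      have b_min: "mdeg b \<le> mdeg x" if "x \<in> insert b A" for x
        using insert.hyps(2) that by auto
      have larger: "y \<in> A" if "x \<in> insert b A" "y \<in> ?L" "mdeg x < mdeg y" for x y
      proof -
        have "y \<in> insert b A" using insert.prems(2) that by blast
        moreover have "y \<noteq> b" using b_min[OF that(1)] that(3) by (metis leD)
        ultimately show ?thesis by simp
      qed
      have V_add: "u + t \<in> V" if "u \<in> V" for u t
        using V that by (simp add: up_closed_def)
      have step: "x + t \<in> ?T \<union> A" if x: "x \<in> insert b A" and t: "t \<noteq> 0" for x t
      proof (cases "d \<le> mdeg (x + t)")
        case True
        moreover have "x \<in> V" using x b A by auto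
        ultimately show ?thesis using V_add by simp
      next
        case False
        moreover have "x \<in> V" using x b A by auto
        ultimately have "x + t \<in> ?L" using V_add by simp
        moreover have "mdeg x < mdeg (x + t)" using t by simp
        ultimately show ?thesis using larger x by blast
      qed
      have "?T \<union> insert b A = (?T \<union> A) \<union> range ((+) b)"
      proof
        show "?T \<union> insert b A \<subseteq> (?T \<union> A) \<union> range ((+) b)"
        proof -
          have "b \<in> range ((+) b)" by (rule range_eqI[of _ _ 0]) simp
          then have "insert b A \<subseteq> A \<union> range ((+) b)" by simp
          from Un_mono[OF subset_refl[of ?T] this] show ?thesis by (simp only: Un_assoc)
        qed
        show "(?T \<union> A) \<union> range ((+) b) \<subseteq> ?T \<union> insert b A"
        proof
          fix u assume "u \<in> (?T \<union> A) \<union> range ((+) b)"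
          then consider "u \<in> ?T \<union> A" | t where "u = b + t" by (elim UnE rangeE) simp_all
          then show "u \<in> ?T \<union> insert b A"
          proof cases
            case (2 t)
            then show ?thesis using step[of b t] by (cases "t = 0") simp_all
          qed simp
        qed
      qed
      moreover have "regularity_le P ((?T \<union> A) \<union> range ((+) b)) d"
      proof (rule regularity_le_adjoin[OF P])
        show "up_closed (?T \<union> A)"
          unfolding up_closed_def
        proof (intro ballI allI)
          fix u t assume u: "u \<in> ?T \<union> A"
          show "u + t \<in> ?T \<union> A"
          proof (cases "u \<in> A \<and> t \<noteq> 0")
            case True
            then show ?thesis using step by simp
          next
            case False
            then show ?thesis using u V_add[of u t] by auto
          qed
        qed
        show "regularity_le P (?T \<union> A) d"
        proof (rule insert.IH[OF A])
          show "\<forall>x \<in> A. \<forall>y \<in> ?L. mdeg x < mdeg y \<longrightarrow> y \<in> A" using larger by blast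
        qed
        show "mdeg b \<le> d" using b by simp
        show "b + w \<in> ?T \<union> A \<longleftrightarrow> supp w \<inter> UNIV \<noteq> {}" for w
        proof (cases "w = 0")
          case True
          then show ?thesis using False b by simp
        next
          case w: False
          then have "supp w \<noteq> {}" by (auto simp: poly_mapping_eq_iff fun_eq_iff in_keys_iff)
          then show ?thesis using step[of b w] w by simp
        qed
      qed
      ultimately show ?thesis by simp
    qed
  qed
  from this[OF \<open>finite ?L\<close> subset_refl] have "regularity_le P (?T \<union> ?L) d" by simp
  moreover have "?T \<union> ?L = V" by auto
  ultimately show ?thesis by simp
qed

lemma truncation_eq_multiples:
  fixes V :: "'n::finite expo set"
  assumes V: "up_closed V" and gen: "\<And>v. v \<in> V \<Longrightarrow> \<exists>w \<in> V. \<exists>t. v = w + t \<and> mdeg w \<le> d"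
  shows "{v \<in> V. d \<le> mdeg v} = multiples {v \<in> V. mdeg v = d}"
proof
  show "multiples {v \<in> V. mdeg v = d} \<subseteq> {v \<in> V. d \<le> mdeg v}"
    using V by (auto simp: multiples_def up_closed_def)
  have "v \<in> V \<Longrightarrow> mdeg v = d + n \<Longrightarrow> v \<in> multiples {v \<in> V. mdeg v = d}" for v n
  proof (induction n arbitrary: v)
    case 0
    then have "v + 0 \<in> multiples {v \<in> V. mdeg v = d}" unfolding multiples_def by fastforce
    then show ?case by simp
  next
    case (Suc n)
    obtain w t where w: "w \<in> V" "v = w + t" "mdeg w \<le> d" using gen Suc.prems by blast
    then have "t \<noteq> 0" using Suc.prems by auto
    then obtain i where "i \<in> supp t" by (auto simp: poly_mapping_eq_iff fun_eq_iff in_keys_iff)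
    then have t: "var_expo i + (t - var_expo i) = t" by (rule expo_split_var)
    define v' where "v' = w + (t - var_expo i)"
    have "v' + var_expo i = w + (var_expo i + (t - var_expo i))"
      by (simp only: v'_def ac_simps)
    then have v: "v = v' + var_expo i"
      by (simp only: t w(2))
    have "v' \<in> V" using w(1) V by (simp add: v'_def up_closed_def)
    moreover have "mdeg v' = d + n" using Suc.prems v by simp
    ultimately have "v' \<in> multiples {v \<in> V. mdeg v = d}" by (rule Suc.IH)
    then show ?case using up_closed_multiples v unfolding up_closed_def by blast
  qed
  then show "{v \<in> V. d \<le> mdeg v} \<subseteq> multiples {v \<in> V. mdeg v = d}"
    by (auto dest!: le_Suc_ex)
qed

proposition regularity_le_stable:
  fixes P :: "('n::{finite,linorder}, 'k::field) free_cplx"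
  assumes "graded_free_resolution_of_field P e" "up_closed V" "stable_expos V"
    and "\<And>v. v \<in> V \<Longrightarrow> \<exists>w \<in> V. \<exists>t. v = w + t \<and> mdeg w \<le> d"
  shows "regularity_le P V d"
  by (rule regularity_le_truncation[OF assms(1,2)], subst truncation_eq_multiples[OF assms(2,4)])
    (use regularity_le_stable_single_degree[OF assms(1,3)] in auto)

section \<open>Generators and Tor in homological degree zero\<close>

text \<open>
  Subtracting the term at \<open>u\<close> from \<open>f\<close> leaves a polynomial in the monomial ideal of \<open>U - {u}\<close>, and
  \<open>U - {u}\<close> is still closed under multiples by minimality of \<open>u\<close>.
\<close>

lemma lookup_mult_at_minimal:
  fixes f g :: "('n, 'k::comm_ring_1) mpol"
  assumes U: "up_closed U" and minimal: "\<And>v t. v \<in> U \<Longrightarrow> u = v + t \<Longrightarrow> v = u"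
    and f: "f \<in> supported_in U"
  shows "Poly_Mapping.lookup (f * g) u = Poly_Mapping.lookup f u * Poly_Mapping.lookup g 0"
proof -
  define c where "c = Poly_Mapping.lookup f u"
  define f' where "f' = f - Poly_Mapping.single u c"
  have "f' \<in> supported_in (U - {u})"
    using f by (auto simp: supported_in_iff_lookup f'_def c_def lookup_minus lookup_single when_def)
  moreover have "up_closed (U - {u})"
    using U minimal unfolding up_closed_def by blast
  ultimately have "f' * g \<in> supported_in (U - {u})"
    by (rule supported_in_mult(2)[rotated])
  then have "Poly_Mapping.lookup (f' * g) u = 0"
    by (simp add: supported_in_iff_lookup)
  moreover have "Poly_Mapping.lookup (Poly_Mapping.single u c * g) u = c * Poly_Mapping.lookup g 0"
  proof -
    have "Poly_Mapping.single u c * g = xmon u * (Poly_Mapping.single 0 c * g)"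
      by (simp add: xmon_def mult_single flip: mult.assoc)
    then have "Poly_Mapping.lookup (Poly_Mapping.single u c * g) (u + 0) =
        Poly_Mapping.lookup (Poly_Mapping.single 0 c * g) 0"
      by (simp only: lookup_xmon_mult_add)
    then show ?thesis by (simp add: lookup_const_mult)
  qed
  moreover have "f * g = f' * g + Poly_Mapping.single u c * g"
    by (simp add: f'_def algebra_simps)
  ultimately show ?thesis by (simp add: lookup_add c_def)
qed

text \<open>
  The functional \<open>v \<mapsto> \<Sum>\<^sub>k [x\<^sup>u]v\<^sub>k \<cdot> e k\<close> on \<open>P\<^sub>0 \<otimes> I\<close> separates \<open>x\<^sup>u\<close> times a basis
  element with \<open>e k \<noteq> 0\<close> from the boundaries: by minimality of \<open>u\<close> it sends the boundary of \<open>w\<close> to the combination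
  of the augmentations of the rows of the matrix with coefficients \<open>[x\<^sup>u]w\<^sub>k\<close>, and those vanish.
\<close>

lemma Tor_zero_nonzero_at_generator:
  fixes P :: "('n::finite, 'k::field) free_cplx"
  assumes P: "graded_free_resolution_of_field P e" and U: "up_closed U" and u: "u \<in> U"
    and minimal: "\<And>v t. v \<in> U \<Longrightarrow> u = v + t \<Longrightarrow> v = u"
  shows "Tor_nonzero 0 (supported_in U :: ('n, 'k) mpol set) (int (mdeg u))"
proof -
  have "1 \<in> augmentation P e ` cmod P UNIV 0"
    using P by (simp add: graded_free_resolution_of_field_def)
  then obtain x where "augmentation P e x = 1" by auto
  then have "\<exists>k < grank P 0. e k \<noteq> 0"
    unfolding augmentation_def by (metis (no_types, lifting) lessThan_iff mult_zero_right sum.neutral zero_neq_one)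
  then obtain k where k: "k < grank P 0" "e k \<noteq> 0" by blast
  then have shift: "gshift P 0 k = 0"
    using P by (simp add: graded_free_resolution_of_field_def)
  define v where "v l = (if l = k then xmon u :: ('n, 'k) mpol else 0)" for l
  have v: "v \<in> cmod_deg P (supported_in U) 0 (int (mdeg u))"
    using k u shift by (auto simp: cmod_deg_iff v_def homogeneous_of_degree_def)
  have "v \<noteq> cdiff P (Suc 0) w" if w: "w \<in> cmod_deg P (supported_in U) (Suc 0) (int (mdeg u))" for w
  proof
    assume vw: "v = cdiff P (Suc 0) w"
    have row: "(\<Sum>l < grank P 0. Poly_Mapping.lookup (gmat P 0 r l) 0 * e l) = 0"
      if r: "r < grank P (Suc 0)" for r
    proof -
      define b where "b s = (if s = r then 1 :: ('n, 'k) mpol else 0)" for s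
      have "b \<in> cmod P UNIV 1" using r by (auto simp: cmod_def b_def)
      then have "augmentation P e (cdiff P 1 b) = 0"
        using P unfolding graded_free_resolution_of_field_def by blast
      moreover have "cdiff P 1 b l = gmat P 0 r l" if "l < grank P 0" for l
        using that r by (simp add: cdiff_Suc b_def if_distrib[of "\<lambda>x. x * _"] cong: if_cong)
      ultimately show ?thesis by (simp add: augmentation_def)
    qed
    have "Poly_Mapping.lookup (v l) u =
        (\<Sum>r < grank P (Suc 0). Poly_Mapping.lookup (w r) u * Poly_Mapping.lookup (gmat P 0 r l) 0)"
      if l: "l < grank P 0" for l
      using l w unfolding vw
      by (auto simp: cdiff_Suc lookup_sum cmod_deg_iff intro!: sum.cong lookup_mult_at_minimal[OF U minimal])
    then have "(\<Sum>l < grank P 0. Poly_Mapping.lookup (v l) u * e l) =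
        (\<Sum>l < grank P 0. \<Sum>r < grank P (Suc 0).
          Poly_Mapping.lookup (w r) u * (Poly_Mapping.lookup (gmat P 0 r l) 0 * e l))"
      by (simp add: sum_distrib_right mult.assoc)
    also have "\<dots> = (\<Sum>r < grank P (Suc 0). Poly_Mapping.lookup (w r) u *
        (\<Sum>l < grank P 0. Poly_Mapping.lookup (gmat P 0 r l) 0 * e l))"
      by (subst sum.swap) (simp add: sum_distrib_left)
    also have "\<dots> = 0" by (simp add: row)
    also have "(\<Sum>l < grank P 0. Poly_Mapping.lookup (v l) u * e l) = e k"
      using k by (simp add: v_def xmon_def if_distrib[of "\<lambda>x. Poly_Mapping.lookup x _ * _"] cong: if_cong)
    finally show False using k by simp
  qed
  then have "v \<notin> cdiff P (Suc 0) ` cmod_deg P (supported_in U) (Suc 0) (int (mdeg u))" by blast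
  moreover have "cdiff P 0 v = (\<lambda>l. 0)" by (simp add: fun_eq_iff)
  ultimately show ?thesis
    unfolding Tor_nonzero_def using P v by blast
qed

lemma Tor_zero_of_rel_acyclic:
  fixes P :: "('n::finite, 'k::field) free_cplx"
  assumes P: "graded_free_resolution_of_field P e" and U: "up_closed U"
    and "rel_acyclic P U {} i j"
  shows "{v \<in> cmod_deg P (supported_in U) i j. cdiff P i v = (\<lambda>l. 0)} =
    cdiff P (Suc i) ` cmod_deg P (supported_in U) (Suc i) j"
proof (intro equalityI subsetI)
  fix v assume "v \<in> {v \<in> cmod_deg P (supported_in U) i j. cdiff P i v = (\<lambda>l. 0)}"
  then obtain w where "w \<in> cmod_deg P (supported_in U) (Suc i) j"
    "\<And>k. v k - cdiff P (Suc i) w k \<in> supported_in {}"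
    using assms(3) by (auto elim!: rel_acyclicE)
  moreover from this(2) have "v = cdiff P (Suc i) w" by (simp add: fun_eq_iff)
  ultimately show "v \<in> cdiff P (Suc i) ` cmod_deg P (supported_in U) (Suc i) j" by blast
next
  fix v assume "v \<in> cdiff P (Suc i) ` cmod_deg P (supported_in U) (Suc i) j"
  then obtain w where w: "w \<in> cmod_deg P (supported_in U) (Suc i) j" "v = cdiff P (Suc i) w"
    by blast
  then show "v \<in> {v \<in> cmod_deg P (supported_in U) i j. cdiff P i v = (\<lambda>l. 0)}"
    using cdiff_cmod_deg[OF P U w(1)] cdiff_cdiff[OF P cmod_deg_imp_cmod[OF w(1)]] by simp
qed

section \<open>Exponents of the gradient ideal\<close>

definition minimal_expos :: "'n expo set \<Rightarrow> 'n expo set"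
  where "minimal_expos U = {u \<in> U. \<forall>v \<in> U. (\<exists>t. u = v + t) \<longrightarrow> v = u}"

definition gradient_expos :: "'n expo set \<Rightarrow> 'n expo set"
  where "gradient_expos U = multiples {u - var_expo i | u i. u \<in> minimal_expos U \<and> i \<in> supp u}"

lemma min_monomials_supported_in:
  "min_monomials (supported_in U :: ('n, 'k::comm_ring_1) mpol set) = minimal_expos U"
  by (auto simp: min_monomials_def minimal_expos_def xmon_dvd_iff)

lemma multiple_of_minimal:
  fixes u :: "'n::finite expo"
  assumes "u \<in> U"
  shows "\<exists>v \<in> minimal_expos U. \<exists>t. u = v + t"
  using assms
proof (induction "mdeg u" arbitrary: u rule: less_induct)
  case less
  show ?case
  proof (cases "u \<in> minimal_expos U")
    case True
    then show ?thesis by (intro bexI[of _ u] exI[of _ 0]) auto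
  next
    case False
    then obtain v t where v: "v \<in> U" "u = v + t" "v \<noteq> u"
      using less.prems by (auto simp: minimal_expos_def)
    then have "mdeg v < mdeg u" by auto
    then obtain w s where "w \<in> minimal_expos U" "v = w + s"
      using less.hyps v(1) by blast
    then show ?thesis using v(2) by (auto simp: add.assoc intro!: bexI[of _ w])
  qed
qed

lemma gradient_expos_eq_empty:
  assumes "0 \<in> U"
  shows "gradient_expos U = {}"
proof -
  have "u = 0" if "u \<in> minimal_expos U" for u
    using that assms by (force simp: minimal_expos_def)
  then show ?thesis by (force simp: gradient_expos_def multiples_def)
qed

text \<open>
  Let \<open>u\<close> be a minimal generator and \<open>x\<^sub>i\<close> a divisor of \<open>ut\<close>. If \<open>x\<^sub>i\<close> divides \<open>t\<close>, then \<open>ut/x\<^sub>i\<close>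
  is a multiple of \<open>u\<close>, hence of \<open>u/x\<^sub>k\<close> for any \<open>k\<close> in the support of \<open>u\<close>, which is nonempty
  because the ideal is proper. Otherwise \<open>x\<^sub>i\<close> divides \<open>u\<close>, and \<open>ut/x\<^sub>i\<close> is a multiple of \<open>u/x\<^sub>i\<close>.
\<close>

lemma gradient_expos_eq:
  fixes U :: "'n::finite expo set"
  assumes U: "up_closed U" and "0 \<notin> U"
  shows "gradient_expos U = {v. \<exists>i. v + var_expo i \<in> U}"
proof (intro equalityI subsetI)
  fix v assume "v \<in> gradient_expos U"
  then obtain u i t where u: "u \<in> minimal_expos U" "i \<in> supp u" and v: "v = (u - var_expo i) + t"
    by (auto simp: gradient_expos_def multiples_def)
  have "v + var_expo i = (var_expo i + (u - var_expo i)) + t"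
    unfolding v by (simp only: ac_simps)
  also have "\<dots> = u + t" by (simp only: expo_split_var[OF u(2)])
  also have "u + t \<in> U"
    using u(1) U by (simp add: minimal_expos_def up_closed_def)
  finally show "v \<in> {v. \<exists>i. v + var_expo i \<in> U}" by blast
next
  fix v assume "v \<in> {v. \<exists>i. v + var_expo i \<in> U}"
  then obtain i where "v + var_expo i \<in> U" by blast
  then obtain u t where u: "u \<in> minimal_expos U" and t: "v + var_expo i = u + t"
    using multiple_of_minimal by blast
  have mem: "(u - var_expo k) + s \<in> gradient_expos U" if "k \<in> supp u" for k s
    using u that unfolding gradient_expos_def multiples_def by blast
  show "v \<in> gradient_expos U"
  proof (cases "i \<in> supp t")
    case True
    have "u \<noteq> 0" using u \<open>0 \<notin> U\<close> by (auto simp: minimal_expos_def)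
    then obtain k where k: "k \<in> supp u" by (auto simp: poly_mapping_eq_iff fun_eq_iff in_keys_iff)
    have "var_expo i + v = var_expo i + (u + (t - var_expo i))"
      using t expo_split_var[OF True] by (metis add.commute add.left_commute)
    then have "v = u + (t - var_expo i)" by (rule add_left_imp_eq)
    also have "\<dots> = (u - var_expo k) + (var_expo k + (t - var_expo i))"
      using expo_split_var[OF k] by (metis add.assoc add.commute)
    finally show ?thesis using mem[OF k] by simp
  next
    case False
    have "Poly_Mapping.lookup (v + var_expo i) i = Poly_Mapping.lookup (u + t) i"
      using t by simp
    then have i: "i \<in> supp u" using False by (auto simp: lookup_add in_keys_iff)
    have "var_expo i + v = var_expo i + ((u - var_expo i) + t)"
      using t expo_split_var[OF i] by (metis add.assoc add.commute)
    then have "v = (u - var_expo i) + t" by (rule add_left_imp_eq)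
    then show ?thesis using mem[OF i] by simp
  qed
qed

text \<open>
  Let \<open>v x\<^sub>i \<in> I\<close>, \<open>m = max v\<close> and \<open>l < m\<close>. If \<open>i \<le> m\<close>, then \<open>x\<^sub>m\<close> is the largest variable of \<open>v x\<^sub>i\<close>,
  and replacing it gives \<open>(x\<^sub>l v/x\<^sub>m) x\<^sub>i \<in> I\<close>. Otherwise \<open>x\<^sub>i\<close> is the largest variable, and replacing it
  gives \<open>x\<^sub>l v = (x\<^sub>l v/x\<^sub>m) x\<^sub>m \<in> I\<close>. Either way \<open>x\<^sub>l v/x\<^sub>m\<close> is a monomial of \<open>\<partial>(I)\<close>.
\<close>

lemma stable_expos_gradient:
  fixes U :: "'n::{finite,linorder} expo set"
  assumes U: "up_closed U" and stable: "stable_expos U"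
  shows "stable_expos (gradient_expos U)"
proof (cases "0 \<in> U")
  case True
  then show ?thesis by (simp add: gradient_expos_eq_empty stable_expos_def)
next
  case False
  have "\<exists>k. var_expo l + (v - var_expo (Max (supp v))) + var_expo k \<in> U"
    if v: "v + var_expo i \<in> U" and "v \<noteq> 0" and l: "l < Max (supp v)" for v i l
  proof -
    define m where "m = Max (supp v)"
    have "supp v \<noteq> {}" using \<open>v \<noteq> 0\<close> by (auto simp: poly_mapping_eq_iff fun_eq_iff in_keys_iff)
    then have m: "m \<in> supp v" by (simp add: m_def)
    define v' where "v' = v - var_expo m"
    have v_eq: "var_expo m + v' = v" unfolding v'_def by (rule expo_split_var[OF m])
    have supp: "supp (v + var_expo i) = insert i (supp v)"
      by (auto simp: in_keys_iff lookup_add lookup_single when_def split: if_splits)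
    have Max: "Max (supp (v + var_expo i)) = max i m"
      unfolding supp m_def by (rule Max_insert) (use \<open>supp v \<noteq> {}\<close> in auto)
    have move: "var_expo l + (v + var_expo i - var_expo (max i m)) \<in> U"
      using stable v l supp Max unfolding stable_expos_def m_def[symmetric]
      by (metis empty_not_insert keys_zero less_max_iff_disj)
    show ?thesis
    proof (cases "i \<le> m")
      case True
      have "v + var_expo i - var_expo m = v' + var_expo i"
        unfolding v'_def by (rule add_diff_var[OF m])
      then have "var_expo l + v' + var_expo i \<in> U"
        using move True by (simp add: max_def add.assoc)
      then show ?thesis unfolding v'_def m_def by blast
    next
      case False
      then have "var_expo l + v \<in> U" using move by (simp add: max_def)
      moreover have "var_expo l + v = var_expo l + v' + var_expo m"
        unfolding v_eq[symmetric] by (simp only: ac_simps)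
      ultimately show ?thesis unfolding v'_def m_def by metis
    qed
  qed
  then show ?thesis
    unfolding stable_expos_def gradient_expos_eq[OF U False] by blast
qed

lemma strongly_stable_expos_gradient:
  fixes U :: "'n::{finite,linorder} expo set"
  assumes U: "up_closed U" and stable: "strongly_stable_expos U"
  shows "strongly_stable_expos (gradient_expos U)"
proof (cases "0 \<in> U")
  case True
  then show ?thesis by (simp add: gradient_expos_eq_empty strongly_stable_expos_def)
next
  case False
  have "var_expo l + (v - var_expo j) + var_expo i \<in> U"
    if v: "v + var_expo i \<in> U" and j: "j \<in> supp v" and l: "l < j" for v i j l
  proof -
    have "j \<in> supp (v + var_expo i)" using j by (auto simp: in_keys_iff lookup_add)
    then have "var_expo l + (v + var_expo i - var_expo j) \<in> U"
      using stable v l by (simp add: strongly_stable_expos_def)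
    then show ?thesis by (simp only: add_diff_var[OF j] add.assoc)
  qed
  then show ?thesis
    unfolding strongly_stable_expos_def gradient_expos_eq[OF U False] by blast
qed

section \<open>The gradient ideal in characteristic zero\<close>

lemma lookup_partial_deriv:
  "Poly_Mapping.lookup (partial_deriv i f) v =
    of_nat (Suc (Poly_Mapping.lookup v i)) * Poly_Mapping.lookup f (v + var_expo i)"
proof -
  let ?w = "v + var_expo i"
  have *: "Poly_Mapping.lookup (Poly_Mapping.single (u - var_expo i)
        (of_nat (Poly_Mapping.lookup u i) * Poly_Mapping.lookup f u)) v =
      (if u = ?w then of_nat (Suc (Poly_Mapping.lookup v i)) * Poly_Mapping.lookup f ?w else 0)" for u
  proof (cases "i \<in> supp u")
    case True
    have *: "u = ?w \<longleftrightarrow> u - var_expo i = v"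
      using expo_split_var[OF True] by (metis add.commute add_diff_cancel_right')
    show ?thesis
    proof (cases "u = ?w")
      case True
      then show ?thesis by (simp add: lookup_add)
    next
      case False
      then show ?thesis using * by (simp add: lookup_single when_def)
    qed
  next
    case False
    then have "u \<noteq> ?w" by (auto simp: in_keys_iff lookup_add)
    then show ?thesis using False by (simp add: in_keys_iff)
  qed
  show ?thesis
    unfolding partial_deriv_def lookup_sum *
    by (simp add: sum.delta' in_keys_iff)
qed

lemma partial_deriv_add: "partial_deriv i (f + g) = partial_deriv i f + partial_deriv i g"
  by (rule poly_mapping_eqI) (simp add: lookup_partial_deriv lookup_add distrib_left)

lemma partial_deriv_0 [simp]: "partial_deriv i 0 = 0"
  by (rule poly_mapping_eqI) (simp add: lookup_partial_deriv)

lemma partial_deriv_single: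
  "partial_deriv i (Poly_Mapping.single u c) =
    Poly_Mapping.single (u - var_expo i) (of_nat (Poly_Mapping.lookup u i) * c)"
  by (cases "c = 0") (simp_all add: partial_deriv_def)

lemma partial_deriv_mult:
  fixes f g :: "('n, 'k::comm_ring_1) mpol"
  shows "partial_deriv i (f * g) = partial_deriv i f * g + f * partial_deriv i g"
proof (induction f rule: mpol_induct)
  case (single u a)
  show ?case
  proof (induction g rule: mpol_induct)
    case (single v b)
    have left: "Poly_Mapping.single (u - var_expo i) (of_nat (Poly_Mapping.lookup u i) * a) *
        Poly_Mapping.single v b =
        Poly_Mapping.single (u + v - var_expo i) (of_nat (Poly_Mapping.lookup u i) * (a * b))"
      for u v :: "'n expo" and a b :: 'k
    proof (cases "i \<in> supp u")
      case True
      then show ?thesis by (simp only: add_diff_var mult_single mult.assoc)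
    qed (simp add: in_keys_iff)
    have "partial_deriv i (Poly_Mapping.single u a * Poly_Mapping.single v b) =
        Poly_Mapping.single (u + v - var_expo i) (of_nat (Poly_Mapping.lookup u i) * (a * b)) +
        Poly_Mapping.single (v + u - var_expo i) (of_nat (Poly_Mapping.lookup v i) * (b * a))"
      by (simp only: partial_deriv_single mult_single lookup_add of_nat_add distrib_right single_add
          mult.commute[of b a] add.commute[of v u])
    then show ?case
      by (simp only: left[symmetric] partial_deriv_single mult.commute[of "Poly_Mapping.single u a"])
  qed (simp add: partial_deriv_add algebra_simps)
qed (simp add: partial_deriv_add algebra_simps)

text \<open>
  Euler's formula. It puts a homogeneous polynomial into the ideal of its partial derivatives as soon
  as its degree is invertible in the coefficients.
\<close>

lemma sum_var_mult_partial_deriv: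
  fixes f :: "('n::finite, 'k::comm_ring_1) mpol"
  assumes "homogeneous_of_degree (int n) f"
  shows "(\<Sum>i\<in>UNIV. xmon (var_expo i) * partial_deriv i f) = Poly_Mapping.single 0 (of_nat n) * f"
proof (rule poly_mapping_eqI)
  fix v
  have "Poly_Mapping.lookup (xmon (var_expo i) * partial_deriv i f) v =
      of_nat (Poly_Mapping.lookup v i) * Poly_Mapping.lookup f v" for i
  proof (cases "i \<in> supp v")
    case True
    let ?w = "v - var_expo i"
    have v: "var_expo i + ?w = v" by (rule expo_split_var[OF True])
    have "Poly_Mapping.lookup (xmon (var_expo i) * partial_deriv i f) (var_expo i + ?w) =
        of_nat (Suc (Poly_Mapping.lookup ?w i)) * Poly_Mapping.lookup f (var_expo i + ?w)"
      unfolding lookup_xmon_mult_add lookup_partial_deriv by (simp only: add.commute)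
    moreover have "Suc (Poly_Mapping.lookup ?w i) = Poly_Mapping.lookup v i"
      using True by (simp add: lookup_minus in_keys_iff)
    ultimately show ?thesis by (simp only: v)
  next
    case False
    then have "v \<notin> range ((+) (var_expo i))" by (auto simp: in_keys_iff lookup_add)
    then show ?thesis using False by (simp add: lookup_xmon_mult_nondvd in_keys_iff)
  qed
  then have "Poly_Mapping.lookup (\<Sum>i\<in>UNIV. xmon (var_expo i) * partial_deriv i f) v =
      of_nat (mdeg v) * Poly_Mapping.lookup f v"
    by (simp add: lookup_sum mdeg_def sum_distrib_right)
  also have "\<dots> = of_nat n * Poly_Mapping.lookup f v"
    using assms by (cases "v \<in> Poly_Mapping.keys f") (auto simp: homogeneous_of_degree_def in_keys_iff)
  also have "\<dots> = Poly_Mapping.lookup (Poly_Mapping.single 0 (of_nat n) * f) v"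
    by (simp only: lookup_const_mult)
  finally show "Poly_Mapping.lookup (\<Sum>i\<in>UNIV. xmon (var_expo i) * partial_deriv i f) v =
    Poly_Mapping.lookup (Poly_Mapping.single 0 (of_nat n) * f) v" .
qed

lemma partial_deriv_in_gradient_ideal: "f \<in> F \<Longrightarrow> partial_deriv i f \<in> gradient_ideal F"
  unfolding gradient_ideal_def by (rule ideal_gen_base) blast

text \<open>
  Some homogeneous generator has a constant term, hence is a constant; by minimality it is
  the only generator, and its derivatives vanish. With redundant generators allowed, as in \<open>{1, x\<^sub>1}\<close>,
  the gradient ideal could be the unit ideal.
\<close>

lemma gradient_ideal_unit_ideal:
  fixes F :: "('n::finite, 'k::field) mpol set"
  assumes "minimal_generating_set F UNIV"
  shows "gradient_ideal F = {0}"
proof -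
  have hom: "\<And>f. f \<in> F \<Longrightarrow> homogeneous f" and gen: "ideal_gen F = UNIV"
    and min: "\<And>G. G \<subset> F \<Longrightarrow> ideal_gen G \<noteq> UNIV"
    using assms unfolding minimal_generating_set_def by blast+
  have "\<exists>f \<in> F. Poly_Mapping.lookup f 0 \<noteq> 0"
  proof (rule ccontr)
    assume "\<not> (\<exists>f \<in> F. Poly_Mapping.lookup f 0 \<noteq> 0)"
    then have F0: "f \<in> supported_in (- {0})" if "f \<in> F" for f
      using that by (auto simp: supported_in_iff_lookup)
    have up: "up_closed (- {0 :: 'n expo})"
      unfolding up_closed_def
    proof (intro ballI allI)
      fix u t :: "'n expo" assume "u \<in> - {0}"
      then have "mdeg (u + t) \<noteq> mdeg (0 :: 'n expo)" by simp
      then show "u + t \<in> - {0}" unfolding Compl_iff singleton_iff by (rule contrapos_nn) (rule arg_cong)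
    qed
    have "ideal_gen F \<subseteq> supported_in (- {0})"
      by (rule ideal_gen_subset_supported_in[OF up F0])
    then have "xmon 0 \<in> (supported_in (- {0}) :: ('n, 'k) mpol set)"
      unfolding gen by (rule subsetD) (rule UNIV_I)
    then show False by simp
  qed
  then obtain f where f: "f \<in> F" "Poly_Mapping.lookup f 0 \<noteq> 0" by blast
  define c where "c = Poly_Mapping.lookup f 0"
  obtain j where "homogeneous_of_degree j f"
    using hom[OF f(1)] by (auto simp: homogeneous_def)
  moreover from this have "j = 0"
    using f(2) by (auto simp: homogeneous_of_degree_def in_keys_iff)
  ultimately have "Poly_Mapping.keys f \<subseteq> {0}"
    by (auto simp: homogeneous_of_degree_def)
  then have f_eq: "f = Poly_Mapping.single 0 c"
    by (intro poly_mapping_eqI) (auto simp: c_def lookup_single when_def in_keys_iff subset_iff)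
  have "g \<in> ideal_gen {f}" for g
  proof -
    have "g = (g * Poly_Mapping.single 0 (inverse c)) * f"
      using f(2) by (simp add: f_eq mult.assoc mult_single)
    then show ?thesis by (metis ideal_gen_base ideal_gen_mult singletonI)
  qed
  then have "ideal_gen {f} = UNIV" by blast
  then have "\<not> {f} \<subset> F" using min by blast
  then have "F = {f}" using f(1) by blast
  then have "{partial_deriv i f | i f. f \<in> F} \<subseteq> {0}"
    by (auto simp: f_eq partial_deriv_single)
  then have "gradient_ideal F \<subseteq> {0}"
    unfolding gradient_ideal_def by (intro ideal_gen_subset) auto
  then show ?thesis by (auto simp: gradient_ideal_def)
qed

text \<open>
  Let \<open>I\<close> be proper. By Euler's formula the generators themselves lie in \<open>\<partial>(I)\<close>, so the product
  rule shows that \<open>\<partial>(I)\<close> contains the partial derivatives of all elements of \<open>I\<close>; those of its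
  minimal monomials are the expected generators up to units.
\<close>

lemma gradient_ideal_char_0:
  fixes F :: "('n::finite, 'k::field) mpol set"
  assumes char: "CHAR('k) = 0" and U: "up_closed U" and F: "minimal_generating_set F (supported_in U)"
  shows "gradient_ideal F = supported_in (gradient_expos U)"
proof (cases "0 \<in> U")
  case True
  then have "U = UNIV" using U unfolding up_closed_def by (metis UNIV_eq_I add_0)
  then show ?thesis using gradient_ideal_unit_ideal[of F] F gradient_expos_eq_empty[OF True] by simp
next
  case False
  let ?V = "gradient_expos U"
  have V: "?V = {v. \<exists>i. v + var_expo i \<in> U}" by (rule gradient_expos_eq[OF U False])
  have hom: "\<And>f. f \<in> F \<Longrightarrow> homogeneous f" and gen: "ideal_gen F = supported_in U"
    using F unfolding minimal_generating_set_def by blast+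
  have F_I: "f \<in> supported_in U" if "f \<in> F" for f
    using gen ideal_gen_base[OF that] by simp
  have of_nat: "(of_nat n :: 'k) \<noteq> 0" if "n \<noteq> 0" for n
    using that char by (simp add: of_nat_eq_0_iff_char_dvd)
  show ?thesis
  proof
    show "gradient_ideal F \<subseteq> supported_in ?V"
      unfolding gradient_ideal_def
    proof (rule ideal_gen_subset_supported_in)
      show "up_closed ?V" by (simp add: gradient_expos_def up_closed_multiples)
      fix g assume "g \<in> {partial_deriv i f | i f. f \<in> F}"
      then obtain i f where g: "g = partial_deriv i f" "f \<in> F" by blast
      show "g \<in> supported_in ?V"
        using F_I[OF g(2)] unfolding supported_in_iff_lookup g(1) lookup_partial_deriv V by auto
    qed
  next
    have F_grad: "f \<in> gradient_ideal F" if f: "f \<in> F" for f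
    proof (cases "f = 0")
      case False
      then obtain v where v: "v \<in> Poly_Mapping.keys f"
        by (auto simp: poly_mapping_eq_iff fun_eq_iff in_keys_iff)
      then have "v \<noteq> 0" using F_I[OF f] \<open>0 \<notin> U\<close> by (auto simp: supported_in_def)
      let ?n = "mdeg v"
      have "homogeneous_of_degree (int ?n) f"
        using hom[OF f] v unfolding homogeneous_def homogeneous_of_degree_def by metis
      then have euler: "(\<Sum>i\<in>UNIV. xmon (var_expo i) * partial_deriv i f) =
          Poly_Mapping.single 0 (of_nat ?n) * f"
        by (rule sum_var_mult_partial_deriv)
      have eq: "Poly_Mapping.single 0 (inverse (of_nat ?n)) *
          (\<Sum>i\<in>UNIV. xmon (var_expo i) * partial_deriv i f) = f"
        unfolding euler mult.assoc[symmetric] mult_single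
        using of_nat[of ?n] \<open>v \<noteq> 0\<close> by simp
      have "Poly_Mapping.single 0 (inverse (of_nat ?n)) *
          (\<Sum>i\<in>UNIV. xmon (var_expo i) * partial_deriv i f) \<in> gradient_ideal F"
        using partial_deriv_in_gradient_ideal[OF f] unfolding gradient_ideal_def
        by (intro ideal_gen_mult ideal_gen_sum)
      then show ?thesis by (simp only: eq)
    qed (simp add: gradient_ideal_def)
    have "ideal_gen F \<subseteq> {g \<in> gradient_ideal F. \<forall>i. partial_deriv i g \<in> gradient_ideal F}"
    proof (rule ideal_gen_subset)
      show "f \<in> {g \<in> gradient_ideal F. \<forall>i. partial_deriv i g \<in> gradient_ideal F}" if "f \<in> F" for f
        using F_grad[OF that] partial_deriv_in_gradient_ideal[OF that] by simp
    qed (simp_all add: gradient_ideal_def partial_deriv_add partial_deriv_mult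
        ideal_gen_add ideal_gen_mult)
    then have deriv: "partial_deriv i (xmon u) \<in> gradient_ideal F" if "u \<in> U" for i u
      using that xmon_supported_in_iff[of u U] unfolding gen by blast
    have "xmon (u - var_expo i) \<in> gradient_ideal F" if u: "u \<in> minimal_expos U" "i \<in> supp u" for u i
    proof -
      have eq: "Poly_Mapping.single 0 (inverse (of_nat (Poly_Mapping.lookup u i))) * partial_deriv i (xmon u)
          = (xmon (u - var_expo i) :: ('n, 'k) mpol)"
        using of_nat[of "Poly_Mapping.lookup u i"] u(2)
        by (simp add: xmon_def partial_deriv_single mult_single in_keys_iff)
      have "u \<in> U" using u(1) by (simp add: minimal_expos_def)
      then have "Poly_Mapping.single 0 (inverse (of_nat (Poly_Mapping.lookup u i))) *
          partial_deriv i (xmon u) \<in> gradient_ideal F"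
        using deriv unfolding gradient_ideal_def by (intro ideal_gen_mult)
      then show ?thesis by (simp only: eq)
    qed
    then show "supported_in ?V \<subseteq> gradient_ideal F"
      unfolding gradient_expos_def ideal_gen_xmon[symmetric] gradient_ideal_def
      by (intro ideal_gen_subset_ideal_gen) auto
  qed
qed

section \<open>Stability and regularity of the gradient ideal\<close>

text \<open>
  Suppose that \<open>Tor\<^sub>i(K, \<partial>(I))\<^sub>j \<noteq> 0\<close>. If all minimal generators of \<open>I\<close> had degree below \<open>j - i\<close>,
  the stable ideal \<open>\<partial>(I)\<close> would be generated in degrees at most \<open>d = j - i - 1\<close>, and its regularity
  would be at most \<open>d\<close>; and if \<open>I\<close> had no generators at all, \<open>\<partial>(I)\<close> would be zero. So \<open>I\<close> has a minimal generator of degree at least \<open>j - i\<close>, and the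
  resolution that computes the nonzero \<open>Tor\<close> detects it in homological degree \<open>0\<close>.
\<close>

proposition cm_reg_gradient_le:
  fixes U :: "'n::{finite,linorder} expo set"
  assumes U: "up_closed U" and stable: "stable_expos U"
  shows "cm_reg (supported_in (gradient_expos U) :: ('n, 'k::field) mpol set) \<le>
    cm_reg (supported_in U :: ('n, 'k) mpol set)"
  unfolding cm_reg_def[of "supported_in (gradient_expos U)"]
proof (rule Sup_least, clarify)
  let ?V = "gradient_expos U"
  have V: "up_closed ?V" by (simp add: gradient_expos_def up_closed_multiples)
  fix i j assume "Tor_nonzero i (supported_in ?V :: ('n, 'k) mpol set) j"
  then obtain P :: "('n, 'k) free_cplx" and e where P: "graded_free_resolution_of_field P e"
    and not_acyclic: "\<not> rel_acyclic P ?V {} i j"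
    using Tor_zero_of_rel_acyclic[OF _ V] unfolding Tor_nonzero_def by blast
  have "\<exists>u \<in> minimal_expos U. j - int i \<le> int (mdeg u)"
  proof (rule ccontr)
    assume "\<not> ?thesis"
    then have low: "int (mdeg u) < j - int i" if "u \<in> minimal_expos U" for u
      using that by auto
    have "rel_acyclic P ?V {} i j"
    proof (cases "minimal_expos U = {}")
      case True
      then have "?V = {}" by (simp add: gradient_expos_def multiples_def)
      then show ?thesis by (simp add: rel_acyclic_empty)
    next
      case False
      then have "0 < j - int i" using low by (metis ex_in_conv le_less_trans of_nat_0_le_iff)
      define d where "d = nat (j - int i - 1)"
      have "\<exists>w \<in> ?V. \<exists>t. v = w + t \<and> mdeg w \<le> d" if v: "v \<in> ?V" for v
      proof -
        obtain u k t where u: "u \<in> minimal_expos U" "k \<in> supp u" "v = (u - var_expo k) + t"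
          using v by (auto simp: gradient_expos_def multiples_def)
        have "mdeg (var_expo k + (u - var_expo k)) = mdeg u"
          by (simp only: expo_split_var[OF u(2)])
        then have "mdeg (u - var_expo k) \<le> d"
          using low[OF u(1)] by (simp add: d_def)
        moreover have "(u - var_expo k) + 0 \<in> ?V"
          using u unfolding gradient_expos_def multiples_def by blast
        ultimately show ?thesis using u(3) by auto
      qed
      then have "regularity_le P ?V d"
        by (intro regularity_le_stable[OF P V stable_expos_gradient[OF U stable]])
      then show ?thesis using \<open>0 < j - int i\<close> by (simp add: regularity_le_def d_def)
    qed
    then show False using not_acyclic by simp
  qed
  then obtain u where u: "u \<in> minimal_expos U" "j - int i \<le> int (mdeg u)" by blast
  then have "Tor_nonzero 0 (supported_in U :: ('n, 'k) mpol set) (int (mdeg u))"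
    by (intro Tor_zero_nonzero_at_generator[OF P U]) (auto simp: minimal_expos_def)
  then have "ereal (real_of_int (int (mdeg u) - int 0)) \<le> cm_reg (supported_in U :: ('n, 'k) mpol set)"
    unfolding cm_reg_def by (intro Sup_upper) blast
  moreover have "ereal (real_of_int (j - int i)) \<le> ereal (real_of_int (int (mdeg u) - int 0))"
    using u(2) by simp
  ultimately show "ereal (real_of_int (j - int i)) \<le> cm_reg (supported_in U :: ('n, 'k) mpol set)"
    by (rule order_trans[rotated])
qed

theorem proposition3p4:
  fixes I F :: "('n::{finite,linorder}, 'k::field) mpol set"
  assumes "monomial_ideal I"
    and "minimal_generating_set F I"
    and "CHAR('k) = 0 \<or>
      gradient_ideal F = ideal_gen {xmon (u - var_expo i) | u i. u \<in> min_monomials I \<and> i \<in> supp u}"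
  shows "(stable_ideal I \<longrightarrow> stable_ideal (gradient_ideal F)) \<and>
    (strongly_stable_ideal I \<longrightarrow> strongly_stable_ideal (gradient_ideal F)) \<and>
    (stable_ideal I \<or> strongly_stable_ideal I \<longrightarrow> cm_reg (gradient_ideal F) \<le> cm_reg I)"
proof -
  obtain U where U: "up_closed U" and I: "I = supported_in U"
    using assms(1) unfolding monomial_ideal_iff by blast
  have "{xmon (u - var_expo i) | u i. u \<in> min_monomials I \<and> i \<in> supp u} =
      (xmon ` {u - var_expo i | u i. u \<in> minimal_expos U \<and> i \<in> supp u} :: ('n, 'k) mpol set)"
    unfolding I min_monomials_supported_in by blast
  then have "ideal_gen {xmon (u - var_expo i) | u i. u \<in> min_monomials I \<and> i \<in> supp u} =
      (supported_in (gradient_expos U) :: ('n, 'k) mpol set)"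
    by (simp only: ideal_gen_xmon gradient_expos_def)
  then have grad: "gradient_ideal F = supported_in (gradient_expos U)"
    using assms(3) gradient_ideal_char_0[OF _ U assms(2)[unfolded I]] by metis
  have V: "up_closed (gradient_expos U)" by (simp add: gradient_expos_def up_closed_multiples)
  show ?thesis
    unfolding grad unfolding I stable_ideal_supported_in[OF U] stable_ideal_supported_in[OF V]
      strongly_stable_ideal_supported_in[OF U] strongly_stable_ideal_supported_in[OF V]
    using stable_expos_gradient[OF U] strongly_stable_expos_gradient[OF U] cm_reg_gradient_le[OF U]
      strongly_stable_imp_stable by blast
qed

end
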